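(* Let $N$ be a non-negative integer and $\gamma,\delta\in\mathbb{C}$. Put $$a=1+\tfrac{\gamma+\delta+N}{2},\qquad b=1+\tfrac{\gamma-\delta+N}{2},\qquad c=-\tfrac{\gamma+\delta+N}{2},$$ and assume that none of $2a,a+b,a+c,2b,b+c,2c$ belongs to $\{0,-1,-2,\dots\}$ and that the denominators in the sum below are nonzero. For $f,g$ polynomials in $\lambda(x)=x(x+\gamma+\delta+1)$, define $$\langle f,g\rangle_S=\langle f,g\rangle_d+\left\langle \left(\tfrac{\Delta}{\Delta\lambda}\right)^{N+1}f,\left(\tfrac{\Delta}{\Delta\lambda}\right)^{N+1}g\right\rangle_c,$$ $$\langle f,g\rangle_d=\sum_{x=0}^{N}f(\lambda(x))g(\lambda(x))\frac{(2x+\gamma+\delta+1)(\gamma+1)_x(-N)_x}{(-1)^x(x+\gamma+\delta+1)_{N+1}(\delta+1)_x\,x!},$$ $$\langle F,G\rangle_c=\int_{C}F(z)G(z)\,\nu\!\left(zi+i+i\tfrac{\gamma+\delta+N}{2}\right)\nu\!\left(-zi-i-i\tfrac{\gamma+\delta+N}{2}\right)dz,$$ where $$\nu(y)=\frac{\Gamma(a+iy)\Gamma(b+iy)\Gamma(c+iy)}{\Gamma(2iy)}$$ and $C$ is the imaginary axis deformed so as to separate the increasing sequences of poles $k,\ -\gamma-\delta-N-1+k,\ -\delta+k$ $(k=0,1,2,\dots)$ from the decreasing sequences $-\gamma-\delta-N-2-k,\ -1-k,\ -\gamma-N-2-k$ $(k=0,1,2,\dots)$. Then the dual Hahn polynomials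 $R_n(\lambda(x);\gamma,\delta,N)$, $n\ge0$, are orthogonal with respect to $\langle\cdot,\cdot\rangle_S$: $\langle R_n,R_m\rangle_S=0$ for all $n\ne m$ in $\mathbb{N}_0$.
   Context: $\mathbb{N}_0=\{0,1,2,\dots\}$; $(a)_0=1$, $(a)_n=a(a+1)\cdots(a+n-1)$. Dual Hahn polynomials of every degree $n\ge 0$ (monic in $\lambda(x)=x(x+\gamma+\delta+1)$) are $$R_n(\lambda(x);\gamma,\delta,N)=\sum_{k=0}^n\frac{(-n)_k(-x)_k(x+\gamma+\delta+1)_k}{k!}(\gamma+1+k)_{n-k}(-N+k)_{n-k}.$$ The iterated divided difference $\left(\frac{\Delta}{\Delta\lambda}\right)^{j}$ on the quadratic lattice is understood as follows: put $\lambda_j(x)=x(x+\gamma+\delta+1+j)$; for $f$ a polynomial in $\lambda(x)$, set $D_0f(x)=f(\lambda(x))$ and $D_{j+1}f(x)=\frac{D_jf(x+1)-D_jf(x)}{\lambda_j(x+1)-\lambda_j(x)}$. Then $D_jf$ is a polynomial in $\lambda_j(x)$, and $\left(\frac{\Delta}{\Delta\lambda}\right)^{j}f:=D_jf$, regarded as a polynomial function of the variable $x$ (evaluated at $x=z$ in $\langle\cdot,\cdot\rangle_c$). The contour $C$ runs from $-i\infty$ to $i\infty$, with the increasing sequences to its right and the decreasing ones to its left. *)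

theory Defs
  imports "HOL-Analysis.Analysis" "HOL-Computational_Algebra.Polynomial"
begin

section \<open>Quadratic lattice and iterated divided differences\<close>

text \<open>\<open>quad_lattice \<gamma> \<delta> j\<close> is the polynomial \<open>x (x + \<gamma> + \<delta> + 1 + j)\<close> in \<open>x\<close>; the case \<open>j = 0\<close>
  is \<open>\<lambda>(x)\<close>. A function that is polynomial in \<open>\<lambda>(x)\<close> is represented by a polynomial \<open>f\<close>
  in the variable \<open>\<lambda>\<close>, so that its value at \<open>x\<close> is \<open>poly f (poly (quad_lattice \<gamma> \<delta> 0) x)\<close>.\<close>

definition quad_lattice :: "complex \<Rightarrow> complex \<Rightarrow> nat \<Rightarrow> complex poly" where
  "quad_lattice \<gamma> \<delta> j = [:0, 1:] * [:\<gamma> + \<delta> + 1 + of_nat j, 1:]"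

text \<open>The iterate is a polynomial in \<open>x\<close>. The polynomial division is exact, see
  \<open>divided_difference_Suc\<close> below; doing it on polynomials rather than pointwise
  gives the correct value also at the zero of the denominator.\<close>

fun divided_difference :: "complex \<Rightarrow> complex \<Rightarrow> nat \<Rightarrow> complex poly \<Rightarrow> complex poly" where
  "divided_difference \<gamma> \<delta> 0 f = pcompose f (quad_lattice \<gamma> \<delta> 0)"
| "divided_difference \<gamma> \<delta> (Suc j) f =
     (pcompose (divided_difference \<gamma> \<delta> j f) [:1, 1:] - divided_difference \<gamma> \<delta> j f) div
     (pcompose (quad_lattice \<gamma> \<delta> j) [:1, 1:] - quad_lattice \<gamma> \<delta> j)"

lemma poly_lattice: "poly (quad_lattice \<gamma> \<delta> j) x = x * (x + \<gamma> + \<delta> + 1 + of_nat j)"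
  by (simp add: quad_lattice_def algebra_simps)

lemma lattice_difference:
  "pcompose (quad_lattice \<gamma> \<delta> j) [:1, 1:] - quad_lattice \<gamma> \<delta> j = [:\<gamma> + \<delta> + 2 + of_nat j, 2:]"
  by (simp add: quad_lattice_def pcompose_pCons algebra_simps)

lemma divided_difference_step:
  fixes q :: "complex poly"
  shows "\<exists>r t. \<forall>x.
    poly q (poly (quad_lattice \<gamma> \<delta> j) (x + 1)) - poly q (poly (quad_lattice \<gamma> \<delta> j) x) =
      (poly (quad_lattice \<gamma> \<delta> j) (x + 1) - poly (quad_lattice \<gamma> \<delta> j) x) * poly r (poly (quad_lattice \<gamma> \<delta> (Suc j)) x)
    \<and> poly q (poly (quad_lattice \<gamma> \<delta> j) (x + 1)) + poly q (poly (quad_lattice \<gamma> \<delta> j) x) =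
      poly t (poly (quad_lattice \<gamma> \<delta> (Suc j)) x)"
proof (induction q)
  case 0
  show ?case by (rule exI[of _ 0], rule exI[of _ 0]) simp
next
  case (pCons c q)
  define s where "s = \<gamma> + \<delta> + 1 + of_nat j"
  define A where "A = (\<lambda>x. poly (quad_lattice \<gamma> \<delta> j) (x + 1))"
  define B where "B = (\<lambda>x. poly (quad_lattice \<gamma> \<delta> j) x)"
  define L where "L = (\<lambda>x. poly (quad_lattice \<gamma> \<delta> (Suc j)) x)"
  from pCons.IH obtain r t where
    r: "\<And>x. poly q (A x) - poly q (B x) = (A x - B x) * poly r (L x)" and
    t: "\<And>x. poly q (A x) + poly q (B x) = poly t (L x)"
    unfolding A_def B_def L_def by blast
  have plus: "A x + B x = poly [:s + 1, 2:] (L x)" for x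
    by (simp add: A_def B_def L_def s_def poly_lattice algebra_simps)
  have sq: "(A x - B x) * (A x - B x) = poly [:(s + 1) * (s + 1), 4:] (L x)" for x
    by (simp add: A_def B_def L_def s_def poly_lattice algebra_simps)
  have d: "A x * poly q (A x) - B x * poly q (B x) =
      (A x - B x) * poly (smult (1/2) ([:s + 1, 2:] * r + t)) (L x)" for x
  proof -
    have "2 * (A x * poly q (A x) - B x * poly q (B x)) =
        (A x + B x) * (poly q (A x) - poly q (B x)) + (A x - B x) * (poly q (A x) + poly q (B x))"
      by (simp add: algebra_simps)
    also have "\<dots> = (A x - B x) * poly ([:s + 1, 2:] * r + t) (L x)"
      unfolding r t plus poly_add poly_mult by (simp only: distrib_left mult_ac)
    finally show ?thesis by (simp add: field_simps)
  qed
  have e: "A x * poly q (A x) + B x * poly q (B x) =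
      poly (smult (1/2) ([:s + 1, 2:] * t + [:(s + 1) * (s + 1), 4:] * r)) (L x)" for x
  proof -
    have "2 * (A x * poly q (A x) + B x * poly q (B x)) =
        (A x + B x) * (poly q (A x) + poly q (B x)) + (A x - B x) * (poly q (A x) - poly q (B x))"
      by (simp add: algebra_simps)
    also have "\<dots> = (A x + B x) * poly t (L x) + ((A x - B x) * (A x - B x)) * poly r (L x)"
      unfolding r t by (simp only: mult.assoc)
    also have "\<dots> = poly ([:s + 1, 2:] * t + [:(s + 1) * (s + 1), 4:] * r) (L x)"
      unfolding sq plus poly_add poly_mult ..
    finally show ?thesis by (simp add: field_simps)
  qed
  define r' where "r' = smult (1/2) ([:s + 1, 2:] * r + t)"
  define t' where "t' = smult (1/2) ([:s + 1, 2:] * t + [:(s + 1) * (s + 1), 4:] * r)"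
  have "poly (pCons c q) (A x) - poly (pCons c q) (B x) = (A x - B x) * poly r' (L x) \<and>
      poly (pCons c q) (A x) + poly (pCons c q) (B x) = poly ([:2 * c:] + t') (L x)" for x
    using d[of x, folded r'_def] e[of x, folded t'_def] by simp
  then show ?case
    unfolding A_def B_def L_def by blast
qed

lemma divided_difference_polynomial:
  "\<exists>q. divided_difference \<gamma> \<delta> j f = pcompose q (quad_lattice \<gamma> \<delta> j)"
  and divided_difference_Suc:
  "poly (divided_difference \<gamma> \<delta> (Suc j) f) x *
     (poly (quad_lattice \<gamma> \<delta> j) (x + 1) - poly (quad_lattice \<gamma> \<delta> j) x) =
   poly (divided_difference \<gamma> \<delta> j f) (x + 1) - poly (divided_difference \<gamma> \<delta> j f) x"
proof -
  have step: "\<exists>r. divided_difference \<gamma> \<delta> (Suc j) f = pcompose r (quad_lattice \<gamma> \<delta> (Suc j)) \<and>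
      pcompose (divided_difference \<gamma> \<delta> j f) [:1, 1:] - divided_difference \<gamma> \<delta> j f =
      (pcompose (quad_lattice \<gamma> \<delta> j) [:1, 1:] - quad_lattice \<gamma> \<delta> j) * pcompose r (quad_lattice \<gamma> \<delta> (Suc j))"
    if q: "divided_difference \<gamma> \<delta> j f = pcompose q (quad_lattice \<gamma> \<delta> j)" for j q
  proof -
    obtain r where r: "\<And>x. poly q (poly (quad_lattice \<gamma> \<delta> j) (x + 1)) - poly q (poly (quad_lattice \<gamma> \<delta> j) x) =
      (poly (quad_lattice \<gamma> \<delta> j) (x + 1) - poly (quad_lattice \<gamma> \<delta> j) x) * poly r (poly (quad_lattice \<gamma> \<delta> (Suc j)) x)"
      using divided_difference_step[of q \<gamma> \<delta> j] by blast
    have eq: "pcompose (divided_difference \<gamma> \<delta> j f) [:1, 1:] - divided_difference \<gamma> \<delta> j f =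
      (pcompose (quad_lattice \<gamma> \<delta> j) [:1, 1:] - quad_lattice \<gamma> \<delta> j) * pcompose r (quad_lattice \<gamma> \<delta> (Suc j))"
      by (rule poly_ext) (use r in \<open>simp add: q poly_pcompose add.commute\<close>)
    moreover have "pcompose (quad_lattice \<gamma> \<delta> j) [:1, 1:] - quad_lattice \<gamma> \<delta> j \<noteq> 0"
      by (simp add: lattice_difference)
    ultimately show ?thesis by auto
  qed
  show poly: "\<exists>q. divided_difference \<gamma> \<delta> j f = pcompose q (quad_lattice \<gamma> \<delta> j)" for j
  proof (induction j)
    case 0
    show ?case by auto
  next
    case (Suc j)
    then show ?case using step by blast
  qed
  obtain q where q: "divided_difference \<gamma> \<delta> j f = pcompose q (quad_lattice \<gamma> \<delta> j)"
    using poly by blast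
  have "pcompose (divided_difference \<gamma> \<delta> j f) [:1, 1:] - divided_difference \<gamma> \<delta> j f =
      (pcompose (quad_lattice \<gamma> \<delta> j) [:1, 1:] - quad_lattice \<gamma> \<delta> j) * divided_difference \<gamma> \<delta> (Suc j) f"
    using step[OF q] by auto
  then have "poly (pcompose (divided_difference \<gamma> \<delta> j f) [:1, 1:] - divided_difference \<gamma> \<delta> j f) x =
      poly ((pcompose (quad_lattice \<gamma> \<delta> j) [:1, 1:] - quad_lattice \<gamma> \<delta> j) * divided_difference \<gamma> \<delta> (Suc j) f) x"
    by (rule arg_cong)
  then show "poly (divided_difference \<gamma> \<delta> (Suc j) f) x *
     (poly (quad_lattice \<gamma> \<delta> j) (x + 1) - poly (quad_lattice \<gamma> \<delta> j) x) =
   poly (divided_difference \<gamma> \<delta> j f) (x + 1) - poly (divided_difference \<gamma> \<delta> j f) x"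
    by (simp add: poly_pcompose add.commute mult.commute del: divided_difference.simps)
qed

section \<open>Dual Hahn polynomials\<close>

definition dual_hahn :: "complex \<Rightarrow> complex \<Rightarrow> nat \<Rightarrow> nat \<Rightarrow> complex poly" where
  "dual_hahn \<gamma> \<delta> N n = (THE p. \<forall>x. poly p (poly (quad_lattice \<gamma> \<delta> 0) x) =
     (\<Sum>k\<le>n. pochhammer (- of_nat n) k * pochhammer (- x) k * pochhammer (x + \<gamma> + \<delta> + 1) k / fact k
        * pochhammer (\<gamma> + 1 + of_nat k) (n - k) * pochhammer (- of_nat N + of_nat k) (n - k)))"

lemma poly_in_lattice_unique:
  assumes "\<And>x. poly p (poly (quad_lattice \<gamma> \<delta> 0) x) = poly q (poly (quad_lattice \<gamma> \<delta> 0) x)"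
  shows "p = q"
proof -
  have "pcompose (p - q) (quad_lattice \<gamma> \<delta> 0) = 0"
    by (rule poly_ext) (simp add: poly_pcompose assms)
  moreover have "degree (quad_lattice \<gamma> \<delta> 0) > 0"
    by (simp add: quad_lattice_def)
  ultimately have "p - q = 0" by (rule pcompose_eq_0)
  then show ?thesis by simp
qed

lemma poly_dual_hahn:
  "poly (dual_hahn \<gamma> \<delta> N n) (poly (quad_lattice \<gamma> \<delta> 0) x) =
     (\<Sum>k\<le>n. pochhammer (- of_nat n) k * pochhammer (- x) k * pochhammer (x + \<gamma> + \<delta> + 1) k / fact k
        * pochhammer (\<gamma> + 1 + of_nat k) (n - k) * pochhammer (- of_nat N + of_nat k) (n - k))"
proof -
  define c :: "nat \<Rightarrow> complex" where "c = (\<lambda>k. pochhammer (- of_nat n) k / fact k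
        * pochhammer (\<gamma> + 1 + of_nat k) (n - k) * pochhammer (- of_nat N + of_nat k) (n - k))"
  define P where "P = (\<Sum>k\<le>n. smult (c k) (\<Prod>i<k. [:of_nat i * (of_nat i + \<gamma> + \<delta> + 1), -1:]))"
  have prod: "pochhammer (- x) k * pochhammer (x + \<gamma> + \<delta> + 1) k =
      (\<Prod>i<k. of_nat i * (of_nat i + \<gamma> + \<delta> + 1) - poly (quad_lattice \<gamma> \<delta> 0) x)" for x k
    by (simp add: pochhammer_prod atLeast0LessThan poly_lattice flip: prod.distrib)
       (simp add: algebra_simps)
  have "poly P (poly (quad_lattice \<gamma> \<delta> 0) x) =
     (\<Sum>k\<le>n. c k * (pochhammer (- x) k * pochhammer (x + \<gamma> + \<delta> + 1) k))" for x
    unfolding prod by (simp add: P_def poly_sum poly_prod)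
  then have P: "\<forall>x. poly P (poly (quad_lattice \<gamma> \<delta> 0) x) =
     (\<Sum>k\<le>n. pochhammer (- of_nat n) k * pochhammer (- x) k * pochhammer (x + \<gamma> + \<delta> + 1) k / fact k
        * pochhammer (\<gamma> + 1 + of_nat k) (n - k) * pochhammer (- of_nat N + of_nat k) (n - k))"
    by (simp add: c_def mult_ac)
  have "dual_hahn \<gamma> \<delta> N n = P"
    unfolding dual_hahn_def
  proof (rule the_equality)
    fix q assume q: "\<forall>x. poly q (poly (quad_lattice \<gamma> \<delta> 0) x) =
     (\<Sum>k\<le>n. pochhammer (- of_nat n) k * pochhammer (- x) k * pochhammer (x + \<gamma> + \<delta> + 1) k / fact k
        * pochhammer (\<gamma> + 1 + of_nat k) (n - k) * pochhammer (- of_nat N + of_nat k) (n - k))"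
    show "q = P"
      by (rule poly_in_lattice_unique[of _ \<gamma> \<delta>]) (simp only: P[rule_format] q[rule_format])
  qed (rule P)
  with P show ?thesis by simp
qed

section \<open>Contours\<close>

text \<open>Infinite contours are parametrised by the whole real line, upwards. The imaginary axis
  is only modified in a bounded region.\<close>

definition deformed_imaginary_axis :: "(real \<Rightarrow> complex) \<Rightarrow> bool" where
  "deformed_imaginary_axis C \<longleftrightarrow>
     inj C \<and> C piecewise_C1_differentiable_on UNIV \<and>
     (\<exists>T. \<forall>t. \<bar>t\<bar> \<ge> T \<longrightarrow> C t = \<i> * of_real t)"

text \<open>A point is to the right (left) of the contour if it lies in the component of the
  complement containing all sufficiently large positive (negative) real numbers;
  in particular it is not on the contour.\<close>

definition right_of_contour :: "(real \<Rightarrow> complex) \<Rightarrow> complex \<Rightarrow> bool" where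
  "right_of_contour C p \<longleftrightarrow> (\<forall>\<^sub>F M in at_top. connected_component (- range C) p (of_real M))"

definition left_of_contour :: "(real \<Rightarrow> complex) \<Rightarrow> complex \<Rightarrow> bool" where
  "left_of_contour C p \<longleftrightarrow> (\<forall>\<^sub>F M in at_bot. connected_component (- range C) p (of_real M))"

text \<open>The integrand of \<open>\<integral>\<^sub>C h(z) dz\<close> pulled back to the real line. The gauge integral over
  the whole line covers improper integrals.\<close>

definition contour_integrand :: "(real \<Rightarrow> complex) \<Rightarrow> (complex \<Rightarrow> complex) \<Rightarrow> real \<Rightarrow> complex" where
  "contour_integrand C h t = h (C t) * vector_derivative C (at t)"

section \<open>The bilinear forms\<close>

definition nu :: "complex \<Rightarrow> complex \<Rightarrow> complex \<Rightarrow> complex \<Rightarrow> complex" where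
  "nu a b c y = Gamma (a + \<i> * y) * Gamma (b + \<i> * y) * Gamma (c + \<i> * y) / Gamma (2 * \<i> * y)"

definition param_a :: "complex \<Rightarrow> complex \<Rightarrow> nat \<Rightarrow> complex" where
  "param_a \<gamma> \<delta> N = 1 + (\<gamma> + \<delta> + of_nat N) / 2"

definition param_b :: "complex \<Rightarrow> complex \<Rightarrow> nat \<Rightarrow> complex" where
  "param_b \<gamma> \<delta> N = 1 + (\<gamma> - \<delta> + of_nat N) / 2"

definition param_c :: "complex \<Rightarrow> complex \<Rightarrow> nat \<Rightarrow> complex" where
  "param_c \<gamma> \<delta> N = - (\<gamma> + \<delta> + of_nat N) / 2"

definition weight_c :: "complex \<Rightarrow> complex \<Rightarrow> nat \<Rightarrow> complex \<Rightarrow> complex" where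
  "weight_c \<gamma> \<delta> N z =
     nu (param_a \<gamma> \<delta> N) (param_b \<gamma> \<delta> N) (param_c \<gamma> \<delta> N)
       (z * \<i> + \<i> + \<i> * (\<gamma> + \<delta> + of_nat N) / 2) *
     nu (param_a \<gamma> \<delta> N) (param_b \<gamma> \<delta> N) (param_c \<gamma> \<delta> N)
       (- z * \<i> - \<i> - \<i> * (\<gamma> + \<delta> + of_nat N) / 2)"

text \<open>\<open>F\<close> and \<open>G\<close> are polynomials in the variable \<open>z\<close> here.\<close>

definition integrand_c ::
  "(real \<Rightarrow> complex) \<Rightarrow> complex \<Rightarrow> complex \<Rightarrow> nat \<Rightarrow> complex poly \<Rightarrow> complex poly \<Rightarrow> real \<Rightarrow> complex" where
  "integrand_c C \<gamma> \<delta> N F G =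
     contour_integrand C (\<lambda>z. poly F z * poly G z * weight_c \<gamma> \<delta> N z)"

definition form_c ::
  "(real \<Rightarrow> complex) \<Rightarrow> complex \<Rightarrow> complex \<Rightarrow> nat \<Rightarrow> complex poly \<Rightarrow> complex poly \<Rightarrow> complex" where
  "form_c C \<gamma> \<delta> N F G = integral UNIV (integrand_c C \<gamma> \<delta> N F G)"

definition form_d :: "complex \<Rightarrow> complex \<Rightarrow> nat \<Rightarrow> complex poly \<Rightarrow> complex poly \<Rightarrow> complex" where
  "form_d \<gamma> \<delta> N f g =
     (\<Sum>x\<le>N. poly f (poly (quad_lattice \<gamma> \<delta> 0) (of_nat x)) * poly g (poly (quad_lattice \<gamma> \<delta> 0) (of_nat x)) *
        ((2 * of_nat x + \<gamma> + \<delta> + 1) * pochhammer (\<gamma> + 1) x * pochhammer (- of_nat N) x /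
         ((-1) ^ x * pochhammer (of_nat x + \<gamma> + \<delta> + 1) (N + 1) * pochhammer (\<delta> + 1) x * fact x)))"

definition form_S ::
  "(real \<Rightarrow> complex) \<Rightarrow> complex \<Rightarrow> complex \<Rightarrow> nat \<Rightarrow> complex poly \<Rightarrow> complex poly \<Rightarrow> complex" where
  "form_S C \<gamma> \<delta> N f g = form_d \<gamma> \<delta> N f g +
     form_c C \<gamma> \<delta> N (divided_difference \<gamma> \<delta> (N + 1) f) (divided_difference \<gamma> \<delta> (N + 1) g)"

end

theory Submission
  imports Defs "HOL-Complex_Analysis.Complex_Analysis"
begin

text \<open>The operator \<open>(\<Delta>/\<Delta>\<lambda>)\<^sup>N\<^sup>+\<^sup>1\<close> kills \<open>R\<^sub>n\<close> for \<open>n \<le> N\<close>, and for \<open>n > N\<close> it turns \<open>R\<^sub>n\<close> into a multiple of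
  the continuous dual Hahn polynomial of degree \<open>n - N - 1\<close>. Both the sum \<open>\<langle>\<cdot>,\<cdot>\<rangle>\<^sub>d\<close> and the integral
  \<open>\<langle>\<cdot>,\<cdot>\<rangle>\<^sub>c\<close> are functionals \<open>L\<close> on polynomials whose weight satisfies the same first order Pearson difference equation,
  with parameters \<open>(A, B, G) = (\<gamma> + \<delta> + 1, \<gamma> + 1, -N)\<close> and \<open>(\<gamma> + \<delta> + N + 2, \<gamma> + N + 2, 1)\<close>. Summation by parts, which
  in the continuous case is a shift of the contour by \<open>1\<close> that meets no poles, gives
  \<open>L((-x)\<^sub>j (x+A)\<^sub>j (B-A-x)\<^sub>i (x+B)\<^sub>i) = (B+i)\<^sub>j (G)\<^sub>j L((B-A-x)\<^sub>i (x+B)\<^sub>i)\<close>, and expanding \<open>R\<^sub>n\<close> in the first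
  factors and the other polynomial in the second ones, orthogonality becomes a Chu-Vandermonde sum.
  The value of the integral is never needed.\<close>

section \<open>Orthogonality from a Pearson equation\<close>

text \<open>Both weights have the form \<open>(2 x + A) w(x)\<close> with
  \<open>(x+A)(x+B)(x+G) w(x) = -(x+1)(B-A-x-1)(G-A-x-1) w(x+1)\<close>, which makes the combination
  in \<open>pearson\<close> a difference \<open>h(x) - h(x+1)\<close>. In the sum the ends vanish
  through the factor \<open>x\<close> at 0 and \<open>x + G\<close> at \<open>N\<close>; in the
  integral a translate of the contour takes their place. There the obstacle is topological:
  \<open>C\<close> may wander, and its two sides are known only as connected components of the
  complement, so no explicit region between \<open>C\<close> and \<open>C + 1\<close> is available.
  Absence of residues is expressed by winding numbers instead: the loop along \<open>C\<close> and
  back along \<open>C + 1\<close> is a difference of two loops sharing a detour on the side away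
  from the pole \<open>p\<close>, and an escape route to infinity shows that the first does not wind
  around \<open>p\<close> and that the second, moved back by 1, does not wind around
  \<open>p - 1\<close>. The analytic obstacle is the exponential growth of the sine that comes from
  \<open>1 / Gamma(2 i y)\<close>; reflection cancels it against four of the six Gamma factors, and
  the other two decay faster than every power.\<close>

definition node_poly :: "(nat \<Rightarrow> complex) \<Rightarrow> nat \<Rightarrow> complex poly" where
  "node_poly e k = (\<Prod>l<k. [:e l, -1:])"

lemma smult_sum_right: "smult u (\<Sum>i\<in>S. f i) = (\<Sum>i\<in>S. smult u (f i))"
  by (induction S rule: infinite_finite_induct) (simp_all add: smult_add_right)

lemma degree_node_poly: "degree (node_poly e k) = k"
  by (simp add: node_poly_def degree_prod_eq_sum_degree)

lemma poly_in_span_node_poly: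
  assumes "degree p < n"
  shows "\<exists>c. p = (\<Sum>i<n. smult (c i) (node_poly e i))"
  using assms
proof (induction n arbitrary: p)
  case (Suc n)
  define l where "l = coeff (node_poly e n) n"
  define q where "q = p - smult (coeff p n / l) (node_poly e n)"
  have l: "l \<noteq> 0"
    using degree_node_poly[of e n] leading_coeff_0_iff[of "node_poly e n"]
    by (auto simp: l_def node_poly_def)
  have deg: "degree q < n" if "n > 0"
  proof -
    have "degree q \<le> n"
      unfolding q_def using Suc.prems degree_node_poly[of e n]
      by (intro degree_diff_le) (auto intro: order.trans[OF degree_smult_le])
    moreover have "coeff q n = 0" using l by (simp add: q_def l_def)
    ultimately show ?thesis
      using that by (metis degree_0 leading_coeff_0_iff le_neq_implies_less)
  qed
  have "\<exists>c. q = (\<Sum>i<n. smult (c i) (node_poly e i))"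
  proof (cases "n > 0")
    case True
    with deg Suc.IH show ?thesis by blast
  next
    \<comment> \<open>For \<open>n = 0\<close> the remainder cannot have degree below 0; here
      \<open>p\<close> is constant and \<open>q\<close> is 0 outright.\<close>
    case False
    then have "degree p = 0" using Suc.prems by simp
    then obtain x where "p = [:x:]" by (rule degree_eq_zeroE)
    then show ?thesis using False l by (simp add: q_def l_def node_poly_def)
  qed
  then obtain c where "q = (\<Sum>i<n. smult (c i) (node_poly e i))" by blast
  then have "p = (\<Sum>i<Suc n. smult ((c(n := coeff p n / l)) i) (node_poly e i))"
    by (simp add: q_def algebra_simps)
  then show ?case by blast
qed simp

abbreviation lattice_nodes :: "complex \<Rightarrow> nat \<Rightarrow> complex" where
  "lattice_nodes A \<equiv> \<lambda>l. of_nat l * (of_nat l + A)"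

text \<open>This is \<open>(B)_n (G)_n 3F2(-n, -x, x+A; B, G; 1)\<close> with the denominators
  \<open>(B)_k (G)_k\<close> multiplied out, so that it keeps its meaning for \<open>G = -N\<close>
  and \<open>n > N\<close>.\<close>

definition hahn_poly :: "complex \<Rightarrow> complex \<Rightarrow> complex \<Rightarrow> nat \<Rightarrow> complex poly" where
  "hahn_poly A B G n = (\<Sum>k\<le>n. smult (pochhammer (- of_nat n) k / fact k *
     pochhammer (B + of_nat k) (n - k) * pochhammer (G + of_nat k) (n - k)) (node_poly (lattice_nodes A) k))"

lemma degree_hahn_poly: "degree (hahn_poly A B G n) \<le> n"
  unfolding hahn_poly_def
  by (intro degree_sum_le) (auto simp: degree_node_poly intro: order.trans[OF degree_smult_le])

text \<open>Each factor splits: \<open>l(l+A) - x(x+A) = (l-x)(l+x+A)\<close>.\<close>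

lemma poly_node_poly_lattice:
  "poly (node_poly (lattice_nodes A) k) (x * (x + A)) = pochhammer (- x) k * pochhammer (x + A) k"
  by (simp add: node_poly_def poly_prod pochhammer_prod atLeast0LessThan flip: prod.distrib)
     (simp add: algebra_simps)

lemma dual_hahn_eq_hahn_poly:
  "dual_hahn \<gamma> \<delta> N n = hahn_poly (\<gamma> + \<delta> + 1) (\<gamma> + 1) (- of_nat N) n"
proof (rule poly_in_lattice_unique[of _ \<gamma> \<delta>])
  fix x
  have lat: "poly (quad_lattice \<gamma> \<delta> 0) x = x * (x + (\<gamma> + \<delta> + 1))"
    by (simp add: poly_lattice algebra_simps)
  show "poly (dual_hahn \<gamma> \<delta> N n) (poly (quad_lattice \<gamma> \<delta> 0) x) =
        poly (hahn_poly (\<gamma> + \<delta> + 1) (\<gamma> + 1) (- of_nat N) n) (poly (quad_lattice \<gamma> \<delta> 0) x)"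
    unfolding poly_dual_hahn unfolding lat hahn_poly_def poly_sum poly_smult poly_node_poly_lattice
    by (simp add: add.assoc mult_ac)
qed

text \<open>After reversing the sign of the second Pochhammer symbol this is the binomial theorem
  for rising factorials with arguments \<open>B + i\<close> and \<open>1 - B - M\<close>. Their sum
  is \<open>-(M-1-i)\<close>, free of \<open>B\<close>, and its rising factorial of length
  \<open>M\<close> runs through 0 because \<open>i < M\<close>.\<close>

lemma chu_vandermonde_vanishing:
  fixes B :: complex
  assumes "i < M"
  shows "(\<Sum>j\<le>M. pochhammer (- of_nat M) j / fact j * pochhammer (B + of_nat j) (M - j) *
           pochhammer (B + of_nat i) j) = 0"
proof -
  have "pochhammer (- of_nat M) j / fact j * pochhammer (B + of_nat j) (M - j) * pochhammer (B + of_nat i) j =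
      (-1) ^ M * (of_nat (M choose j) * pochhammer (B + of_nat i) j * pochhammer (1 - B - of_nat M) (M - j))"
    if j: "j \<le> M" for j
  proof -
    have 1: "pochhammer (- of_nat M) j / fact j = (-1) ^ j * (of_nat (M choose j) :: complex)"
      by (simp add: gbinomial_pochhammer binomial_gbinomial)
    have 2: "pochhammer (B + of_nat j) (M - j) = (-1) ^ (M - j) * pochhammer (1 - B - of_nat M) (M - j)"
      using pochhammer_minus[of "- (1 - B - of_nat M)" "M - j"] j
      by (simp add: of_nat_diff algebra_simps)
    have 3: "(-1) ^ j * (-1) ^ (M - j) = ((-1) ^ M :: complex)"
      using j by (simp flip: power_add)
    show ?thesis unfolding 1 2 3[symmetric] by simp
  qed
  then have "(\<Sum>j\<le>M. pochhammer (- of_nat M) j / fact j * pochhammer (B + of_nat j) (M - j) *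
           pochhammer (B + of_nat i) j) =
     (-1) ^ M * pochhammer ((B + of_nat i) + (1 - B - of_nat M)) M"
    unfolding pochhammer_binomial_sum sum_distrib_left by (intro sum.cong) auto
  also have "(B + of_nat i) + (1 - B - of_nat M) = - of_nat (M - Suc i)"
    using assms by (simp add: of_nat_diff)
  also have "pochhammer (- of_nat (M - Suc i)) M = (0 :: complex)"
    using assms by (intro pochhammer_of_nat_eq_0_lemma) auto
  finally show ?thesis by simp
qed

text \<open>The hypothesis \<open>pearson\<close> is a summation by parts. With \<open>s = x + A/2\<close> and \<open>a = A/2\<close>,
  \<open>b = B - A/2\<close>, \<open>c = G - A/2\<close> its right-hand side is
  \<open>(a + s)(b + s)(c + s) r (x + 1) - (a - s)(b - s)(c - s) r x\<close>.\<close>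

definition lat :: "complex \<Rightarrow> complex poly" where "lat A = [:0, A, 1:]"

locale pearson_functional =
  fixes L :: "complex poly \<Rightarrow> complex" and A B G :: complex
  assumes L_add: "L (p + q) = L p + L q"
    and L_smult: "L (smult u p) = u * L p"
    and pearson: "(\<And>x. (2 * x + A) * poly q x =
        (x + A) * (x + B) * (x + G) * poly r (x + 1) + x * (B - A - x) * (G - A - x) * poly r x) \<Longrightarrow> L q = 0"
begin

lemma L_sum: "finite S \<Longrightarrow> L (sum f S) = (\<Sum>i\<in>S. L (f i))"
proof (induction rule: finite_induct)
  case empty
  show ?case using L_smult[of 0 0] by simp
qed (simp add: L_add)

definition u where "u j = pcompose (node_poly (lattice_nodes A) j) (lat A)"

text \<open>Multiplying a weight that contains \<open>Gamma(B-A-x) Gamma(x+B)\<close> by this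
  product replaces \<open>B\<close> by \<open>B + i\<close>. That is why \<open>B + i\<close> takes
  the place of \<open>B\<close> in the evaluation of \<open>L (u j * v i)\<close>.\<close>

definition v where "v i = pcompose (node_poly (\<lambda>l. (B - A + of_nat l) * (B + of_nat l)) i) (lat A)"

lemma poly_u: "poly (u j) x = pochhammer (- x) j * pochhammer (x + A) j"
proof -
  have "poly (lat A) x = x * (x + A)" by (simp add: lat_def algebra_simps)
  then show ?thesis by (simp add: u_def poly_pcompose poly_node_poly_lattice)
qed

lemma poly_v: "poly (v i) x = pochhammer (B - A - x) i * pochhammer (x + B) i"
  by (simp add: v_def lat_def poly_pcompose node_poly_def poly_prod pochhammer_prod atLeast0LessThan
      flip: prod.distrib) (simp add: algebra_simps)

lemma L_u_Suc: "L (u (Suc j) * v i) = (B + of_nat i + of_nat j) * (G + of_nat j) * L (u j * v i)"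
proof -
  let ?k = "(B + of_nat i + of_nat j) * (G + of_nat j)"
  define q where "q = smult ?k (u j * v i) + smult (-1) (u (Suc j) * v i)"
  \<comment> \<open>Compared with \<open>u j * v i\<close>, the symbols with argument
    \<open>-x\<close> and \<open>B-A-x\<close> start one step later. With
    \<open>y (y+1)_n = (y+n) (y)_n\<close> both \<open>r(x+1)\<close> and \<open>r(x)\<close>, times
    their cubic coefficients, then contain \<open>u j * v i\<close> as a factor.\<close>
  define r where "r = (\<Prod>l<j. [:A + of_nat l, 1:] * [:1 + of_nat l, -1:]) *
     (\<Prod>l<i. [:B + of_nat l, 1:] * [:B - A + 1 + of_nat l, -1:])"
  have r: "poly r x = pochhammer (x + A) j * pochhammer (1 - x) j *
      (pochhammer (x + B) i * pochhammer (B - A - x + 1) i)" for x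
    unfolding r_def poly_mult poly_prod prod.distrib
    by (simp add: pochhammer_prod atLeast0LessThan algebra_simps)
  have "L q = 0"
  proof (rule pearson[of q r])
    fix x
    have up: "y * pochhammer (y + 1) n = (y + of_nat n) * pochhammer y n" for y :: complex and n
      using pochhammer_rec[of y n] pochhammer_Suc[of y n] by (simp add: mult.commute)
    have r1: "poly r (x + 1) = pochhammer (x + A + 1) j * pochhammer (- x) j *
        (pochhammer (x + B + 1) i * pochhammer (B - A - x) i)"
    proof -
      have "B - A - (x + 1) + 1 = B - A - x" "1 - (x + 1) = - x" "x + 1 + A = x + A + 1" "x + 1 + B = x + B + 1"
        by simp_all
      then show ?thesis unfolding r by (simp only:)
    qed
    have r0: "poly r x = pochhammer (x + A) j * pochhammer (- x + 1) j *
        (pochhammer (x + B) i * pochhammer (B - A - x + 1) i)"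
      unfolding r by simp
    have "(x + A) * (x + B) * (x + G) * poly r (x + 1) =
        ((x + A) * pochhammer (x + A + 1) j) * ((x + B) * pochhammer (x + B + 1) i) *
        ((x + G) * pochhammer (- x) j * pochhammer (B - A - x) i)"
      unfolding r1 by (simp only: mult_ac)
    then have e1: "(x + A) * (x + B) * (x + G) * poly r (x + 1) =
       (x + A + of_nat j) * (x + B + of_nat i) * (x + G) *
         (pochhammer (- x) j * pochhammer (x + A) j * (pochhammer (B - A - x) i * pochhammer (x + B) i))"
      unfolding up by (simp only: mult_ac)
    have "(- x) * (B - A - x) * (G - A - x) * poly r x =
        ((- x) * pochhammer (- x + 1) j) * ((B - A - x) * pochhammer (B - A - x + 1) i) *
        ((G - A - x) * pochhammer (x + A) j * pochhammer (x + B) i)"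
      unfolding r0 by (simp only: mult_ac)
    then have e2: "(- x) * (B - A - x) * (G - A - x) * poly r x =
       (- x + of_nat j) * (B - A - x + of_nat i) * (G - A - x) *
         (pochhammer (- x) j * pochhammer (x + A) j * (pochhammer (B - A - x) i * pochhammer (x + B) i))"
      unfolding up by (simp only: mult_ac)
    have u': "poly (u (Suc j)) x = (of_nat j - x) * (x + A + of_nat j) *
         (pochhammer (- x) j * pochhammer (x + A) j)"
      by (simp add: poly_u pochhammer_Suc)
    have "(2 * x + A) * poly q x = ((2 * x + A) * (?k - (of_nat j - x) * (x + A + of_nat j))) *
       (pochhammer (- x) j * pochhammer (x + A) j * (pochhammer (B - A - x) i * pochhammer (x + B) i))"
      unfolding q_def poly_add poly_smult poly_mult u' poly_v by (simp add: poly_u algebra_simps)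
    \<comment> \<open>With \<open>s = x + A/2\<close>, \<open>a = A/2 + j\<close>,
      \<open>b = B - A/2 + i\<close>, \<open>c = G - A/2\<close> the right side is the odd cubic
      \<open>(a+s)(b+s)(c+s) - (a-s)(b-s)(c-s) = 2s (ab + ac + bc + s^2)\<close>. On the left
      \<open>?k\<close> is \<open>(a+b)(a+c)\<close> and the subtracted product is
      \<open>a^2 - s^2\<close>.\<close>
    also have "(2 * x + A) * (?k - (of_nat j - x) * (x + A + of_nat j)) =
       (x + A + of_nat j) * (x + B + of_nat i) * (x + G) -
       (- x + of_nat j) * (B - A - x + of_nat i) * (G - A - x)"
      by algebra
    finally show "(2 * x + A) * poly q x =
        (x + A) * (x + B) * (x + G) * poly r (x + 1) + x * (B - A - x) * (G - A - x) * poly r x"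
      unfolding left_diff_distrib e1[symmetric] e2[symmetric] by simp
  qed
  then show ?thesis by (simp add: q_def L_add L_smult del: smult_minus_left)
qed

lemma L_u: "L (u j * v i) = pochhammer (B + of_nat i) j * pochhammer G j * L (v i)"
proof (induction j)
  case 0
  show ?case by (simp add: u_def node_poly_def pcompose_1)
next
  case (Suc j)
  then show ?case unfolding L_u_Suc by (simp add: pochhammer_Suc)
qed

theorem L_hahn_poly_eq_0:
  assumes "degree q < M"
  shows "L (pcompose (hahn_poly A B G M) (lat A) * pcompose q (lat A)) = 0"
proof -
  have v: "L (pcompose (hahn_poly A B G M) (lat A) * v i) = 0" if "i < M" for i
  proof -
    have "pcompose (hahn_poly A B G M) (lat A) * v i = (\<Sum>j\<le>M. smult (pochhammer (- of_nat M) j / fact j *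
       pochhammer (B + of_nat j) (M - j) * pochhammer (G + of_nat j) (M - j)) (u j * v i))"
      by (simp add: hahn_poly_def pcompose_sum pcompose_smult sum_distrib_right u_def)
    then have "L (pcompose (hahn_poly A B G M) (lat A) * v i) = (\<Sum>j\<le>M. pochhammer (- of_nat M) j / fact j *
       pochhammer (B + of_nat j) (M - j) * pochhammer (G + of_nat j) (M - j) *
       (pochhammer (B + of_nat i) j * pochhammer G j * L (v i)))"
      by (simp add: L_sum L_smult L_u)
    \<comment> \<open>\<open>(G)_j (G+j)_(M-j) = (G)_M\<close> does not depend on \<open>j\<close>;
      \<open>G\<close> leaves the sum, and no division by a possibly vanishing \<open>(G)_j\<close>
      occurs.\<close>
    also have "\<dots> = (\<Sum>j\<le>M. (pochhammer (- of_nat M) j / fact j * pochhammer (B + of_nat j) (M - j) *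
           pochhammer (B + of_nat i) j) * (pochhammer G M * L (v i)))"
      by (intro sum.cong) (auto simp: pochhammer_product)
    also have "\<dots> = 0"
      unfolding sum_distrib_right[symmetric] chu_vandermonde_vanishing[OF that] by simp
    finally show ?thesis .
  qed
  obtain c where "q = (\<Sum>i<M. smult (c i) (node_poly (\<lambda>l. (B - A + of_nat l) * (B + of_nat l)) i))"
    using poly_in_span_node_poly[OF assms] by blast
  then have "pcompose (hahn_poly A B G M) (lat A) * pcompose q (lat A) =
      (\<Sum>i<M. smult (c i) (pcompose (hahn_poly A B G M) (lat A) * v i))"
    by (simp add: pcompose_sum pcompose_smult sum_distrib_left v_def)
  then show ?thesis by (simp add: L_sum L_smult v)
qed

end

section \<open>Divided differences and the discrete part\<close>

lemma divided_difference_add: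
  "divided_difference \<gamma> \<delta> j (f + g) = divided_difference \<gamma> \<delta> j f + divided_difference \<gamma> \<delta> j g"
proof (induction j)
  case (Suc j)
  have "pcompose (p + q) w - (p + q) = (pcompose p w - p) + (pcompose q w - q)" for p q w :: "complex poly"
    by (simp add: pcompose_add)
  then show ?case unfolding divided_difference.simps Suc.IH by (simp only: poly_div_add_left)
qed (simp add: pcompose_add)

lemma divided_difference_smult:
  "divided_difference \<gamma> \<delta> j (smult u f) = smult u (divided_difference \<gamma> \<delta> j f)"
proof (induction j)
  case (Suc j)
  have "pcompose (smult u p) w - smult u p = smult u (pcompose p w - p)" for p w :: "complex poly"
    by (simp add: pcompose_smult smult_diff_right)
  then show ?case unfolding divided_difference.simps Suc.IH by (simp only: div_smult_left)
qed (simp add: pcompose_smult)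

lemma divided_difference_sum:
  "divided_difference \<gamma> \<delta> j (\<Sum>i\<in>S. f i) = (\<Sum>i\<in>S. divided_difference \<gamma> \<delta> j (f i))"
proof (induction S rule: infinite_finite_induct)
  case empty
  show ?case using divided_difference_smult[of \<gamma> \<delta> j 0 0] by simp
next
  case (infinite S)
  show ?case using divided_difference_smult[of \<gamma> \<delta> j 0 0] infinite by simp
qed (simp add: divided_difference_add)

text \<open>Both products share \<open>(-x)_n (x+s+1)_n\<close>, leaving a quadratic whose leading
  terms cancel. For \<open>s = \<gamma> + \<delta> + 1 + j\<close> the factor
  \<open>2x + s + 1\<close> is the lattice step, and the shift to \<open>s + 1\<close> is the
  passage to lattice \<open>j + 1\<close>.\<close>

lemma pochhammer_product_difference:
  fixes x s :: complex
  shows "pochhammer (- (x + 1)) (Suc n) * pochhammer (x + 1 + s) (Suc n) - pochhammer (- x) (Suc n) * pochhammer (x + s) (Suc n) =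
    - of_nat (Suc n) * (2 * x + s + 1) * (pochhammer (- x) n * pochhammer (x + s + 1) n)"
proof -
  have "pochhammer (- (x + 1)) (Suc n) = - (x + 1) * pochhammer (- x) n"
    by (simp add: pochhammer_rec)
  moreover have "pochhammer (x + 1 + s) (Suc n) = pochhammer (x + s + 1) n * (x + s + 1 + of_nat n)"
    by (simp add: pochhammer_Suc add_ac)
  moreover have "pochhammer (x + s) (Suc n) = (x + s) * pochhammer (x + s + 1) n"
    by (simp add: pochhammer_rec)
  moreover have "pochhammer (- x) (Suc n) = pochhammer (- x) n * (- x + of_nat n)"
    by (simp add: pochhammer_Suc)
  moreover have "of_nat (Suc n) = (1 + of_nat n :: complex)" by simp
  ultimately show ?thesis by algebra
qed

text \<open>Each difference lowers the degree in the Newton basis by one, moves to the next lattice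
  and contributes \<open>-(k-j)\<close>; these factors multiply up to \<open>(-k)_j\<close>. Once
  \<open>j > k\<close> this coefficient is 0, so the truncated \<open>k - j\<close> does no
  harm.\<close>

lemma divided_difference_node_poly:
  "divided_difference \<gamma> \<delta> j (node_poly (lattice_nodes (\<gamma> + \<delta> + 1)) k) =
     smult (pochhammer (- of_nat k) j)
       (pcompose (node_poly (lattice_nodes (\<gamma> + \<delta> + 1 + of_nat j)) (k - j)) (quad_lattice \<gamma> \<delta> j))"
proof (induction j)
  case 0
  show ?case by simp
next
  case (Suc j)
  let ?D = "divided_difference \<gamma> \<delta> (Suc j) (node_poly (lattice_nodes (\<gamma> + \<delta> + 1)) k)"
  let ?T = "smult (pochhammer (- of_nat k) (Suc j))
       (pcompose (node_poly (lattice_nodes (\<gamma> + \<delta> + 1 + of_nat (Suc j))) (k - Suc j)) (quad_lattice \<gamma> \<delta> (Suc j)))"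
  let ?w = "[:\<gamma> + \<delta> + 2 + of_nat j, 2:]"
  define s where "s = \<gamma> + \<delta> + 1 + of_nat j"
  have lat: "poly (quad_lattice \<gamma> \<delta> j) x = x * (x + s)" for x
    by (simp add: poly_lattice s_def algebra_simps)
  have lat': "poly (quad_lattice \<gamma> \<delta> (Suc j)) x = x * (x + (s + 1))" for x
    by (simp add: poly_lattice s_def algebra_simps)
  have w: "poly ?w x = 2 * x + s + 1" for x
    by (simp add: s_def algebra_simps)
  have w': "poly (quad_lattice \<gamma> \<delta> j) (x + 1) - poly (quad_lattice \<gamma> \<delta> j) x = poly ?w x" for x
    by (simp add: poly_lattice algebra_simps)
  \<comment> \<open>The quotient is compared after multiplication by the lattice step, a nonzero
    polynomial that is cancelled at the end; the zero of the step thus needs no separate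
    care.\<close>
  have "?D * ?w = ?T * ?w"
  proof (rule poly_ext)
    fix x
    have "poly (?D * ?w) x = pochhammer (- of_nat k) j *
       (pochhammer (- (x + 1)) (k - j) * pochhammer (x + 1 + s) (k - j) - pochhammer (- x) (k - j) * pochhammer (x + s) (k - j))"
      unfolding poly_mult w'[symmetric] divided_difference_Suc
      unfolding Suc.IH poly_smult poly_pcompose lat s_def[symmetric] poly_node_poly_lattice
      by (simp add: right_diff_distrib)
    also have "\<dots> = poly (?T * ?w) x"
    proof (cases "j < k")
      case True
      then obtain n where n: "k = Suc (j + n)" using less_imp_Suc_add by blast
      have s1: "\<gamma> + \<delta> + 1 + of_nat (Suc j) = s + 1" by (simp add: s_def)
      have k: "k - j = Suc n" "k - Suc j = n" using n by auto
      have p: "pochhammer (- of_nat k) (Suc j) = pochhammer (- of_nat k) j * (- of_nat (Suc n) :: complex)"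
        by (simp add: pochhammer_Suc n)
      show ?thesis
        unfolding k pochhammer_product_difference poly_mult poly_smult poly_pcompose lat' s1 poly_node_poly_lattice w p
        by (simp only: add.assoc mult_ac)
    next
      case False
      then have "pochhammer (- of_nat k) (Suc j) = (0 :: complex)"
        by (intro pochhammer_of_nat_eq_0_lemma) auto
      then show ?thesis using False by simp
    qed
    finally show "poly (?D * ?w) x = poly (?T * ?w) x" .
  qed
  moreover have "?w \<noteq> 0" by simp
  ultimately show ?case using mult_right_cancel[of ?w ?D ?T] by (simp only: simp_thms)
qed

lemma sum_drop_zeros:
  fixes F :: "nat \<Rightarrow> 'a :: comm_monoid_add"
  assumes "\<And>k. k < m \<Longrightarrow> F k = 0"
  shows "(\<Sum>k\<le>m + n. F k) = (\<Sum>j\<le>n. F (m + j))"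
proof (induction n)
  case 0
  have "(\<Sum>k<m. F k) = 0" using assms by simp
  then show ?case by (simp flip: lessThan_Suc_atMost)
qed (simp_all add: add.commute)

text \<open>The terms with \<open>k \<le> N\<close> carry \<open>(-k)_(N+1) = 0\<close>. In the
  others \<open>k = N + 1 + j\<close> turns \<open>\<gamma> + 1 + k\<close> into
  \<open>\<gamma> + N + 2 + j\<close> and \<open>-N + k\<close> into \<open>1 + j\<close>, which is
  where the parameters of the continuous polynomials come from.\<close>

lemma divided_difference_dual_hahn:
  "divided_difference \<gamma> \<delta> (Suc N) (dual_hahn \<gamma> \<delta> N (Suc N + M)) =
     smult ((-1) ^ Suc N * pochhammer (- of_nat (Suc N + M)) (Suc N))
       (pcompose (hahn_poly (\<gamma> + \<delta> + of_nat N + 2) (\<gamma> + of_nat N + 2) 1 M) (quad_lattice \<gamma> \<delta> (Suc N)))"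
proof -
  let ?n = "Suc N + M"
  let ?c = "\<lambda>k. pochhammer (- of_nat ?n) k / fact k * pochhammer (\<gamma> + 1 + of_nat k) (?n - k) *
      pochhammer (- of_nat N + of_nat k) (?n - k) * pochhammer (- of_nat k) (Suc N) :: complex"
  let ?A = "\<gamma> + \<delta> + of_nat N + 2"
  let ?P = "\<lambda>k. pcompose (node_poly (lattice_nodes ?A) k) (quad_lattice \<gamma> \<delta> (Suc N))"
  have A: "\<gamma> + \<delta> + 1 + of_nat (Suc N) = ?A" by simp
  have "divided_difference \<gamma> \<delta> (Suc N) (dual_hahn \<gamma> \<delta> N ?n) = (\<Sum>k\<le>?n. smult (?c k) (?P (k - Suc N)))"
    unfolding dual_hahn_eq_hahn_poly hahn_poly_def divided_difference_sum divided_difference_smult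
      divided_difference_node_poly A smult_smult ..
  also have "\<dots> = (\<Sum>j\<le>M. smult (?c (Suc N + j)) (?P j))"
    by (subst sum_drop_zeros) (auto simp: pochhammer_of_nat_eq_0_lemma simp del: pochhammer_Suc of_nat_Suc)
  also have "\<dots> = (\<Sum>j\<le>M. smult ((-1) ^ Suc N * pochhammer (- of_nat ?n) (Suc N) *
      (pochhammer (- of_nat M) j / fact j * pochhammer (\<gamma> + of_nat N + 2 + of_nat j) (M - j) *
        pochhammer (1 + of_nat j) (M - j))) (?P j))"
  proof (intro sum.cong refl, goal_cases)
    case (1 j)
    have 2: "pochhammer (- of_nat ?n) (Suc N + j) = pochhammer (- of_nat ?n) (Suc N) * (pochhammer (- of_nat M) j :: complex)"
      unfolding pochhammer_product' by simp
    have "fact (Suc N + j) = (fact j * pochhammer (1 + of_nat j) (Suc N) :: complex)"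
      using pochhammer_product'[of "1 :: complex" j "Suc N"] by (simp only: pochhammer_fact add.commute)
    moreover have "pochhammer (- of_nat (Suc N + j)) (Suc N) = (-1) ^ Suc N * (pochhammer (1 + of_nat j) (Suc N) :: complex)"
      unfolding pochhammer_minus by (simp add: add.commute)
    moreover have "fact (Suc N + j) \<noteq> (0::complex)" "fact j \<noteq> (0::complex)" by (simp_all only: fact_nonzero not_False_eq_True)
    \<comment> \<open>The factor produced by the differences removes exactly the top
      \<open>N + 1\<close> factors of \<open>k!\<close>, so the sum over \<open>j\<close> again has
      \<open>1 / j!\<close>.\<close>
    ultimately have 3: "pochhammer (- of_nat (Suc N + j)) (Suc N) / fact (Suc N + j) = ((-1) ^ Suc N / fact j :: complex)"
      by (simp add: field_simps del: pochhammer_Suc fact_Suc power_Suc)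
    have 4: "?n - (Suc N + j) = M - j" "\<gamma> + 1 + of_nat (Suc N + j) = \<gamma> + of_nat N + 2 + of_nat j"
      "- of_nat N + of_nat (Suc N + j) = (1 + of_nat j :: complex)"
      by simp_all
    have "?c (Suc N + j) = pochhammer (- of_nat ?n) (Suc N + j) * pochhammer (\<gamma> + of_nat N + 2 + of_nat j) (M - j) *
        pochhammer (1 + of_nat j) (M - j) * (pochhammer (- of_nat (Suc N + j)) (Suc N) / fact (Suc N + j))"
      unfolding 4 by (simp only: times_divide_eq_left times_divide_eq_right mult_ac)
    then show ?case unfolding 2 3 by (simp only: times_divide_eq_left times_divide_eq_right mult_ac)
  qed
  also have "\<dots> = smult ((-1) ^ Suc N * pochhammer (- of_nat ?n) (Suc N))
       (pcompose (hahn_poly ?A (\<gamma> + of_nat N + 2) 1 M) (quad_lattice \<gamma> \<delta> (Suc N)))"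
    unfolding hahn_poly_def pcompose_sum pcompose_smult smult_sum_right smult_smult by (rule refl)
  finally show ?thesis .
qed

lemma divided_difference_dual_hahn_eq_0:
  assumes "n \<le> N"
  shows "divided_difference \<gamma> \<delta> (Suc N) (dual_hahn \<gamma> \<delta> N n) = 0"
proof -
  have "pochhammer (- of_nat k) (Suc N) = (0 :: complex)" if "k \<le> n" for k
    using that assms by (intro pochhammer_of_nat_eq_0_lemma) auto
  then show ?thesis
    unfolding dual_hahn_eq_hahn_poly hahn_poly_def divided_difference_sum divided_difference_smult
      divided_difference_node_poly by (simp del: pochhammer_Suc)
qed

section \<open>Summation by parts for the discrete form\<close>

lemma form_d_commute: "form_d \<gamma> \<delta> N f g = form_d \<gamma> \<delta> N g f"
  unfolding form_d_def by (intro sum.cong refl) (simp only: mult.commute mult.left_commute)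

lemma form_d_dual_hahn_eq_0:
  assumes nz: "\<And>x. x \<le> N \<Longrightarrow>
      (-1) ^ x * pochhammer (of_nat x + \<gamma> + \<delta> + 1) (N + 1) * pochhammer (\<delta> + 1) x * fact x \<noteq> 0"
    and "degree g < n"
  shows "form_d \<gamma> \<delta> N (dual_hahn \<gamma> \<delta> N n) g = 0"
proof -
  define A where "A = \<gamma> + \<delta> + 1"
  define B where "B = \<gamma> + 1"
  define G :: complex where "G = - of_nat N"
  \<comment> \<open>The weight without its factor \<open>2x + A\<close>; this is the
    \<open>w\<close> that satisfies a first order recurrence.\<close>
  define E where "E x = pochhammer (\<gamma> + 1) x * pochhammer (- of_nat N) x /
         ((-1) ^ x * pochhammer (of_nat x + \<gamma> + \<delta> + 1) (N + 1) * pochhammer (\<delta> + 1) x * fact x)" for x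
  define L where "L p = (\<Sum>x\<le>N. poly p (of_nat x) * ((2 * of_nat x + A) * E x))" for p
  have E_Suc: "(of_nat x + A) * (of_nat x + B) * (of_nat x + G) * E x =
      - (of_nat (Suc x) * (B - A - of_nat (Suc x)) * (G - A - of_nat (Suc x)) * E (Suc x))" if "x < N" for x
  proof -
    have nz1: "(-1) ^ x * pochhammer (of_nat x + \<gamma> + \<delta> + 1) (N + 1) * pochhammer (\<delta> + 1) x * fact x \<noteq> 0"
      using nz[of x] that by simp
    have nz2: "(-1) ^ Suc x * pochhammer (of_nat (Suc x) + \<gamma> + \<delta> + 1) (N + 1) * pochhammer (\<delta> + 1) (Suc x) * fact (Suc x) \<noteq> 0"
      using nz[of "Suc x"] that by simp
    define K where "K = of_nat x + A + of_nat N + 1"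
    define X where "X = of_nat x + A"
    define P where "P = pochhammer (of_nat x + \<gamma> + \<delta> + 1) (N + 1)"
    define P' where "P' = pochhammer (of_nat (Suc x) + \<gamma> + \<delta> + 1) (N + 1)"
    \<comment> \<open>Both sides are the rising factorial of length \<open>N + 2\<close> starting at
      \<open>x + A\<close>, split off at either end.\<close>
    have P: "X * P' = K * P"
      using pochhammer_rec[of "of_nat x + \<gamma> + \<delta> + 1" "N + 1"] pochhammer_Suc[of "of_nat x + \<gamma> + \<delta> + 1" "N + 1"]
      by (simp add: P_def P'_def A_def X_def K_def add_ac mult_ac)
    define Q where "Q = (-1) ^ x * pochhammer (\<delta> + 1) x * fact x"
    define R where "R = pochhammer (\<gamma> + 1) x * pochhammer (- of_nat N) x"
    have E1: "E x = R / (P * Q)"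
      by (simp add: E_def R_def P_def Q_def)
    have E2: "E (Suc x) = R * ((of_nat x + B) * (of_nat x + G)) / (P' * (- Q * (of_nat x + \<delta> + 1) * of_nat (Suc x)))"
      unfolding E_def P'_def[symmetric] by (simp add: R_def Q_def pochhammer_Suc B_def G_def mult_ac add_ac)
    have nz: "P \<noteq> 0" "P' \<noteq> 0" "Q \<noteq> 0" "of_nat x + \<delta> + 1 \<noteq> 0"
      using nz1 nz2 by (auto simp: P_def P'_def Q_def pochhammer_Suc add_ac)
    define Y where "Y = (of_nat x + B) * (of_nat x + G)"
    define u where "u = of_nat x + \<delta> + 1"
    define n1 :: complex where "n1 = of_nat (Suc x)"
    have s: "B - A - n1 = - u" "G - A - n1 = - K"
      by (simp_all add: A_def B_def G_def u_def n1_def K_def)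
    have "n1 \<noteq> 0" unfolding n1_def by (simp del: of_nat_Suc)
    have "- (n1 * (B - A - n1) * (G - A - n1) * E (Suc x)) =
        (K * R * Y * (n1 * u)) / (P' * Q * (n1 * u))"
      unfolding s E2 Y_def[symmetric] u_def[symmetric] n1_def[symmetric] by simp
    also have "\<dots> = (K * R * Y) / (P' * Q)"
      using nz \<open>n1 \<noteq> 0\<close> unfolding u_def[symmetric] by simp
    also have "\<dots> = (X * R * Y) / (P * Q)"
    proof -
      have "(K * R * Y) * (P * Q) = (X * R * Y) * (P' * Q)"
        using P by algebra
      then show ?thesis using nz by (subst frac_eq_eq) auto
    qed
    also have "\<dots> = (of_nat x + A) * (of_nat x + B) * (of_nat x + G) * E x"
      unfolding E1 Y_def X_def by simp
    finally show ?thesis by (simp add: n1_def del: of_nat_Suc)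
  qed
  interpret pearson_functional L A B G
  proof
    show "L (p + q) = L p + L q" for p q
      by (simp add: L_def distrib_right sum.distrib)
    show "L (smult u p) = u * L p" for u p
      by (simp add: L_def sum_distrib_left mult.assoc)
    fix q r assume *: "\<And>x. (2 * x + A) * poly q x =
        (x + A) * (x + B) * (x + G) * poly r (x + 1) + x * (B - A - x) * (G - A - x) * poly r x"
    \<comment> \<open>Cutting \<open>h\<close> off beyond \<open>N\<close> is consistent with the
      recurrence because \<open>x + G = 0\<close> at \<open>x = N\<close>. The other end of the
      telescoping sum vanishes through the factor \<open>x\<close>.\<close>
    define h where "h x = (if x \<le> N then of_nat x * (B - A - of_nat x) * (G - A - of_nat x) * E x * poly r (of_nat x) else 0)" for x
    have "poly q (of_nat x) * ((2 * of_nat x + A) * E x) = h x - h (Suc x)" if "x \<le> N" for x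
    proof -
      have "poly q (of_nat x) * ((2 * of_nat x + A) * E x) = ((2 * of_nat x + A) * poly q (of_nat x)) * E x"
        by (simp only: mult_ac)
      also have "\<dots> = h x + (of_nat x + A) * (of_nat x + B) * (of_nat x + G) * E x * poly r (of_nat (Suc x))"
        unfolding * using that by (simp add: h_def distrib_left distrib_right mult_ac add.commute)
      also have "(of_nat x + A) * (of_nat x + B) * (of_nat x + G) * E x * poly r (of_nat (Suc x)) = - h (Suc x)"
      proof (cases "x = N")
        case True
        then show ?thesis by (simp add: h_def G_def)
      next
        case False
        then have "x < N" using that by simp
        then show ?thesis unfolding E_Suc[OF \<open>x < N\<close>] by (simp add: h_def del: of_nat_Suc)
      qed
      finally show ?thesis by simp
    qed
    then have "L q = (\<Sum>x<Suc N. h x - h (Suc x))"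
      unfolding L_def lessThan_Suc_atMost by (intro sum.cong) auto
    also have "\<dots> = h 0 - h (Suc N)" by (rule sum_lessThan_telescope')
    finally show "L q = 0" by (simp add: h_def)
  qed
  have "lat A = quad_lattice \<gamma> \<delta> 0" by (simp add: lat_def quad_lattice_def A_def)
  then have "form_d \<gamma> \<delta> N (dual_hahn \<gamma> \<delta> N n) g = L (pcompose (hahn_poly A B G n) (lat A) * pcompose g (lat A))"
    unfolding form_d_def L_def dual_hahn_eq_hahn_poly A_def[symmetric] B_def[symmetric] G_def[symmetric]
    by (intro sum.cong refl) (simp add: poly_pcompose E_def A_def B_def G_def mult.assoc add.assoc)
  then show ?thesis using L_hahn_poly_eq_0[OF assms(2)] by simp
qed

section \<open>Shifting a separating contour\<close>

lemma deformed_imaginary_axisE: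
  assumes "deformed_imaginary_axis C"
  obtains T B where "T \<ge> 1" "\<And>t. \<bar>t\<bar> \<ge> T \<Longrightarrow> C t = \<i> * of_real t" "\<And>t. \<bar>Re (C t)\<bar> \<le> B"
    "closed (range C)" "continuous_on UNIV C"
proof -
  from assms obtain T0 where T0: "\<And>t. \<bar>t\<bar> \<ge> T0 \<Longrightarrow> C t = \<i> * of_real t"
    by (auto simp: deformed_imaginary_axis_def)
  define T where "T = max T0 1"
  have T: "C t = \<i> * of_real t" if "\<bar>t\<bar> \<ge> T" for t using T0 that by (simp add: T_def)
  have cont: "continuous_on UNIV C"
    using assms by (auto simp: deformed_imaginary_axis_def piecewise_C1_differentiable_on_def)
  have comp: "compact (C ` {-T..T})"
    using cont by (intro compact_continuous_image) (auto intro: continuous_on_subset)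
  then obtain B where B: "\<And>z. z \<in> C ` {-T..T} \<Longrightarrow> norm z \<le> B" by (metis bounded_iff compact_imp_bounded)
  have "\<bar>Re (C t)\<bar> \<le> max B 0" for t
  proof (cases "\<bar>t\<bar> \<ge> T")
    case False
    then have "norm (C t) \<le> B" by (intro B imageI) auto
    then show ?thesis using abs_Re_le_cmod[of "C t"] by linarith
  qed (simp add: T)
  moreover have "closed (range C)"
  proof -
    have "range C = C ` {-T..T} \<union> {z. Re z = 0 \<and> \<bar>Im z\<bar> \<ge> T}"
    proof (intro equalityI subsetI)
      fix z assume "z \<in> range C"
      then obtain t where t: "z = C t" by blast
      show "z \<in> C ` {-T..T} \<union> {z. Re z = 0 \<and> \<bar>Im z\<bar> \<ge> T}"
      proof (cases "\<bar>t\<bar> \<ge> T")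
        case False
        then have "t \<in> {-T..T}" by auto
        then show ?thesis using t by blast
      qed (use T[of t] t in auto)
    next
      fix z assume "z \<in> C ` {-T..T} \<union> {z. Re z = 0 \<and> \<bar>Im z\<bar> \<ge> T}"
      then show "z \<in> range C"
      proof
        assume "z \<in> {z. Re z = 0 \<and> \<bar>Im z\<bar> \<ge> T}"
        then have "z = C (Im z)" using T[of "Im z"] by (auto simp: complex_eq_iff)
        then show ?thesis by blast
      qed auto
    qed
    moreover have "closed {z. Re z = 0 \<and> \<bar>Im z\<bar> \<ge> T}"
      by (intro closed_Collect_conj closed_Collect_eq closed_Collect_le continuous_intros)
    ultimately show ?thesis using comp by (simp add: closed_Un compact_imp_closed)
  qed
  moreover have "T \<ge> 1" by (simp add: T_def)
  ultimately show ?thesis using that T cont by blast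
qed

lemma winding_number_zero_unbounded_connected:
  assumes "path K" "pathfinish K = pathstart K"
    and "connected S" "\<not> bounded S" "p \<in> S" "S \<inter> path_image K = {}"
  shows "winding_number K p = 0"
proof (rule winding_number_zero_in_outside[OF assms(1,2)])
  have "S \<subseteq> connected_component_set (- path_image K) p"
    using assms by (intro connected_component_maximal) auto
  then show "p \<in> outside (path_image K)"
    using assms bounded_subset by (auto simp: outside)
qed

text \<open>The sign \<open>\<sigma>\<close> treats both sides of the contour at once: \<open>1\<close> for the right, \<open>-1\<close> for the left.\<close>

definition on_side :: "(real \<Rightarrow> complex) \<Rightarrow> real \<Rightarrow> complex \<Rightarrow> bool" where
  "on_side C \<sigma> p \<longleftrightarrow> (\<forall>\<^sub>F M in at_top. connected_component (- range C) p (of_real (\<sigma> * M)))"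

lemma right_of_contour_on_side: "right_of_contour C p \<longleftrightarrow> on_side C 1 p"
  by (simp add: right_of_contour_def on_side_def)

lemma left_of_contour_on_side: "left_of_contour C p \<longleftrightarrow> on_side C (-1) p"
  by (simp add: left_of_contour_def on_side_def at_bot_mirror eventually_filtermap)

lemma on_side_notin_range:
  assumes "on_side C \<sigma> p"
  shows "p \<notin> range C"
proof -
  from assms obtain M where "connected_component (- range C) p (of_real (\<sigma> * M))"
    unfolding on_side_def using eventually_happens'[OF trivial_limit_at_top_linorder] by blast
  then show ?thesis using connected_component_in by blast
qed

text \<open>A path from \<open>p\<close> to \<open>\<sigma> M\<close> avoiding \<open>C\<close>,
  continued by the real ray beyond, escapes to infinity without meeting such a loop. The path is
  bounded, so large \<open>R\<close> keeps it away from the far part; on the ray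
  \<open>\<sigma> Re z > 1\<close>. The threshold for \<open>R\<close> must not depend on the loop,
  since the loops used below vary with \<open>R\<close>. The bound 1 instead of 0 leaves room for
  translating a loop by -1.\<close>

lemma winding_number_zero_on_side:
  assumes C: "deformed_imaginary_axis C" and \<sigma>: "\<sigma> = 1 \<or> \<sigma> = -1" and p: "on_side C \<sigma> p"
  shows "\<forall>\<^sub>F R in at_top. \<forall>K. path K \<longrightarrow> pathfinish K = pathstart K \<longrightarrow>
    path_image K \<subseteq> range C \<union> {z. R \<le> \<bar>Re z\<bar> + \<bar>Im z\<bar> \<and> \<sigma> * Re z \<le> 1} \<longrightarrow> winding_number K p = 0"
proof -
  obtain T B where T: "T \<ge> 1" "\<And>t. \<bar>t\<bar> \<ge> T \<Longrightarrow> C t = \<i> * of_real t"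
    and B: "\<And>t. \<bar>Re (C t)\<bar> \<le> B" and cl: "closed (range C)" "continuous_on UNIV C"
    using deformed_imaginary_axisE[OF C] by metis
  \<comment> \<open>Beyond \<open>B\<close> the ray misses the contour, and beyond 1 it misses the
    far part of the loop.\<close>
  have "\<forall>\<^sub>F M in at_top. connected_component (- range C) p (of_real (\<sigma> * M)) \<and> M > max B 1"
    using p eventually_gt_at_top[of "max B 1"] unfolding on_side_def by (rule eventually_conj)
  then obtain M where M: "connected_component (- range C) p (of_real (\<sigma> * M))" "M > B" "M > 1"
    using eventually_happens'[OF trivial_limit_at_top_linorder] by force
  have "open (- range C)" using cl by auto
  then have "path_component (- range C) p (of_real (\<sigma> * M))"
    using M(1) by (simp add: open_path_connected_component)
  then obtain \<gamma> where \<gamma>: "path \<gamma>" "path_image \<gamma> \<subseteq> - range C" "pathstart \<gamma> = p" "pathfinish \<gamma> = of_real (\<sigma> * M)"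
    by (auto simp: path_component_def)
  obtain R0 where R0: "\<And>z. z \<in> path_image \<gamma> \<Longrightarrow> norm z \<le> R0"
    by (metis bounded_iff \<gamma>(1) bounded_path_image)
  define ray where "ray = (\<lambda>x. complex_of_real (\<sigma> * x)) ` {M..}"
  have conn: "connected (path_image \<gamma> \<union> ray)"
  proof (rule connected_Un)
    show "connected ray" unfolding ray_def
      by (intro connected_continuous_image continuous_intros) auto
    show "connected (path_image \<gamma>)" using \<gamma>(1) by (rule connected_path_image)
    have "of_real (\<sigma> * M) \<in> path_image \<gamma> \<inter> ray"
      using \<gamma>(4) by (auto simp: ray_def) (metis pathfinish_in_path_image of_real_mult)
    then show "path_image \<gamma> \<inter> ray \<noteq> {}" by blast
  qed
  have unb: "\<not> bounded (path_image \<gamma> \<union> ray)"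
  proof
    assume "bounded (path_image \<gamma> \<union> ray)"
    then obtain b where b: "\<And>z. z \<in> path_image \<gamma> \<union> ray \<Longrightarrow> norm z \<le> b" by (metis bounded_iff)
    have "norm (complex_of_real (\<sigma> * (max M (\<bar>b\<bar> + 1)))) \<le> b"
      by (rule b) (unfold ray_def, intro UnI2 imageI, simp)
    then show False using \<sigma> by (auto simp: abs_mult norm_mult)
  qed
  have "winding_number K p = 0"
    if R: "R > 2 * R0" and K: "path K" "pathfinish K = pathstart K"
      "path_image K \<subseteq> range C \<union> {z. R \<le> \<bar>Re z\<bar> + \<bar>Im z\<bar> \<and> \<sigma> * Re z \<le> 1}" for R K
  proof (rule winding_number_zero_unbounded_connected[OF K(1,2) conn unb])
    show "p \<in> path_image \<gamma> \<union> ray" using \<gamma>(3) by auto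
    have "z \<notin> path_image K" if "z \<in> path_image \<gamma>" for z
      using K(3) \<gamma>(2) that R R0[OF that] abs_Re_le_cmod[of z] abs_Im_le_cmod[of z] by fastforce
    moreover have "z \<notin> path_image K" if z: "z \<in> ray" for z
    proof -
      obtain x where x: "z = of_real (\<sigma> * x)" "x \<ge> M" using z by (auto simp: ray_def simp flip: of_real_mult)
      have s: "\<sigma> * Re z = x" "\<bar>Re z\<bar> = x" using x M \<sigma> by auto
      then have "z \<notin> range C" using B x M by (metis imageE not_less order.strict_trans1)
      then have "z \<notin> range C \<union> {z. R \<le> \<bar>Re z\<bar> + \<bar>Im z\<bar> \<and> \<sigma> * Re z \<le> 1}"
        using s(1) x(2) M by simp
      then show ?thesis using K(3) by blast
    qed
    ultimately show "(path_image \<gamma> \<union> ray) \<inter> path_image K = {}" by blast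
  qed
  then show ?thesis
    by (intro eventually_mono[OF eventually_gt_at_top[of "2 * R0"]]) blast
qed

definition contour_part :: "(real \<Rightarrow> complex) \<Rightarrow> real \<Rightarrow> real \<Rightarrow> complex" where
  "contour_part C R = (\<lambda>u. C (2 * R * u - R))"

text \<open>Up along \<open>C\<close>, across to \<open>C + 1\<close>, down along
  \<open>C + 1\<close> and back. The pieces fit together only when \<open>C\<close> takes the values
  \<open>\<plusminus>\<i> R\<close> at \<open>\<plusminus>R\<close>, hence for large
  \<open>R\<close>.\<close>

definition shift_loop :: "(real \<Rightarrow> complex) \<Rightarrow> real \<Rightarrow> real \<Rightarrow> complex" where
  "shift_loop C R = contour_part C R +++ linepath (\<i> * of_real R) (1 + \<i> * of_real R) +++
     reversepath (\<lambda>u. contour_part C R u + 1) +++ linepath (1 - \<i> * of_real R) (- \<i> * of_real R)"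

lemma path_image_contour_part: "R > 0 \<Longrightarrow> path_image (contour_part C R) = C ` {-R..R}"
proof -
  assume R: "R > 0"
  have "(\<lambda>u. 2 * R * u - R) ` {0..1} = {-R..R}"
  proof (intro equalityI subsetI)
    fix x assume "x \<in> {-R..R}"
    then have "x = 2 * R * ((x + R) / (2 * R)) - R" "(x + R) / (2 * R) \<in> {0..1}"
      using R by (auto simp: field_simps)
    then show "x \<in> (\<lambda>u. 2 * R * u - R) ` {0..1}" by (rule image_eqI)
  next
    fix x assume "x \<in> (\<lambda>u. 2 * R * u - R) ` {0..1}"
    then obtain u where "x = 2 * R * u - R" "u \<in> {0..1}" by (rule imageE)
    then show "x \<in> {-R..R}" using R by (auto simp: mult_left_le)
  qed
  then have "C ` (\<lambda>u. 2 * R * u - R) ` {0..1} = C ` {-R..R}" by (rule arg_cong)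
  then show ?thesis by (simp add: path_image_def contour_part_def image_image)
qed

lemma valid_path_contour_part:
  assumes "deformed_imaginary_axis C" "R > 0"
  shows "valid_path (contour_part C R)"
proof -
  have "C piecewise_C1_differentiable_on ((\<lambda>u. 2 * R * u + - R) ` {0..1})"
    using assms(1) by (auto simp: deformed_imaginary_axis_def intro: piecewise_C1_differentiable_on_subset)
  from piecewise_C1_differentiable_affine[OF this]
  show ?thesis by (simp add: valid_path_def contour_part_def o_def)
qed

text \<open>The segment is an edge of the square \<open>|Re z| + |Im z| = R\<close>, in the half
  plane away from side \<open>\<sigma>\<close>. This is why distance is measured by
  \<open>|Re z| + |Im z|\<close> in the far region.\<close>

lemma slanted_segment:
  assumes "R \<ge> 0" "\<sigma> = 1 \<or> \<sigma> = -1" "y = \<i> * of_real R \<or> y = - \<i> * of_real R"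
    and "z \<in> closed_segment y (of_real (- \<sigma> * R))"
  shows "\<bar>Re z\<bar> + \<bar>Im z\<bar> = R \<and> \<sigma> * Re z \<le> 0"
proof -
  obtain u where u: "0 \<le> u" "u \<le> 1" and z: "z = (1 - u) *\<^sub>R y + u *\<^sub>R of_real (- \<sigma> * R)"
    using assms(4) unfolding in_segment by blast
  have Re: "Re z = - (\<sigma> * (u * R))" and Im: "\<bar>Im z\<bar> = (1 - u) * R"
    using assms u by (auto simp: z abs_mult)
  have "0 \<le> u * R" using u assms by simp
  then show ?thesis unfolding Re Im using assms(2) by (elim disjE) (simp_all add: left_diff_distrib)
qed

lemma unit_segment:
  fixes y :: complex
  assumes "z \<in> closed_segment y (1 + y)" "Re y = 0"
  shows "Im z = Im y \<and> 0 \<le> Re z \<and> Re z \<le> 1"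
proof -
  obtain u where u: "0 \<le> u" "u \<le> 1" and z: "z = (1 - u) *\<^sub>R y + u *\<^sub>R (1 + y)"
    using assms(1) unfolding in_segment by blast
  show ?thesis using u assms(2) unfolding z by (simp add: algebra_simps)
qed

text \<open>Close up the piece of \<open>C\<close>, and likewise the piece of \<open>C + 1\<close>,
  by the same detour through \<open>- \<sigma> R\<close>. The first loop does not wind around
  \<open>p\<close>; the second, translated by -1, does not wind around \<open>p - 1\<close>. In
  their difference the detour cancels and the shift loop remains.\<close>

lemma winding_number_shift_loop:
  assumes C: "deformed_imaginary_axis C" and \<sigma>: "\<sigma> = 1 \<or> \<sigma> = -1"
    and p: "on_side C \<sigma> p" "on_side C \<sigma> (p - 1)"
  shows "\<forall>\<^sub>F R in at_top. winding_number (shift_loop C R) p = 0"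
proof -
  obtain T where T: "T \<ge> 1" "\<And>t. \<bar>t\<bar> \<ge> T \<Longrightarrow> C t = \<i> * of_real t"
    using deformed_imaginary_axisE[OF C] by metis
  have ev: "\<forall>\<^sub>F R in at_top. \<forall>K. path K \<longrightarrow> pathfinish K = pathstart K \<longrightarrow>
    path_image K \<subseteq> range C \<union> {z. R - 1 \<le> \<bar>Re z\<bar> + \<bar>Im z\<bar> \<and> \<sigma> * Re z \<le> 1} \<longrightarrow> winding_number K q = 0"
    if "on_side C \<sigma> q" for q
  proof -
    \<comment> \<open>Translation by -1 changes \<open>|Re z| + |Im z|\<close> by at most 1, hence
      the radius \<open>R - 1\<close> for both loops.\<close>
    have "filterlim (\<lambda>R::real. R - 1) at_top at_top" by real_asymp
    from eventually_compose_filterlim[OF winding_number_zero_on_side[OF C \<sigma> that] this]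
    show ?thesis .
  qed
  have "\<forall>\<^sub>F R in at_top. R > max (max T 2) (\<bar>Re p\<bar> + \<bar>Im p\<bar> + 1)" by (rule eventually_gt_at_top)
  with ev[OF p(1)] ev[OF p(2)] show ?thesis
  proof eventually_elim
    case (elim R)
    then have R: "R > T" "R > 2" "R > \<bar>Re p\<bar> + \<bar>Im p\<bar> + 1" by simp_all
    define y where "y = \<i> * of_real R"
    define l where "l = complex_of_real (- \<sigma> * R)"
    let ?g = "contour_part C R"
    let ?g1 = "\<lambda>u. contour_part C R u + 1"
    have v: "path ?g" "valid_path ?g" using valid_path_contour_part[OF C, of R] R by (auto simp: valid_path_imp_path)
    have v1: "path ?g1"
      using v(1) by (auto simp: path_def intro!: continuous_intros)
    have ends: "pathstart ?g = - y" "pathfinish ?g = y" "pathstart ?g1 = 1 - y" "pathfinish ?g1 = 1 + y"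
      using T(2)[of R] T(2)[of "-R"] R T(1) by (simp_all add: pathstart_def pathfinish_def contour_part_def y_def)
    have im: "path_image ?g \<subseteq> range C"
      using path_image_contour_part[of R C] R by auto
    then have im1: "path_image ?g1 \<subseteq> (\<lambda>z. z + 1) ` range C"
      by (auto simp: path_image_def)
    have L1: "\<bar>Re z\<bar> + \<bar>Im z\<bar> = R \<and> \<sigma> * Re z \<le> 0" if "z \<in> closed_segment y l" for z
      using slanted_segment[OF _ \<sigma> _ that[unfolded l_def]] R by (simp add: y_def)
    have L2: "\<bar>Re z\<bar> + \<bar>Im z\<bar> = R \<and> \<sigma> * Re z \<le> 0" if "z \<in> closed_segment l (- y)" for z
    proof -
      have "z \<in> closed_segment (- y) (of_real (- \<sigma> * R))"
        using that unfolding l_def by (subst closed_segment_commute)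
      then show ?thesis using slanted_segment[OF _ \<sigma>, of R "- y" z] R by (simp add: y_def)
    qed
    have S1: "\<bar>Im z\<bar> = R \<and> 0 \<le> Re z \<and> Re z \<le> 1" if "z \<in> closed_segment (1 + y) y" for z
      using unit_segment[OF that[unfolded closed_segment_commute[of "1 + y"]]] R by (simp add: y_def)
    have S2: "\<bar>Im z\<bar> = R \<and> 0 \<le> Re z \<and> Re z \<le> 1" if "z \<in> closed_segment (- y) (1 - y)" for z
      using unit_segment[of z "- y"] R that by (simp add: y_def)
    have notin: "p \<notin> path_image ?g" "p \<notin> path_image ?g1"
      using im im1 on_side_notin_range[OF p(1)] on_side_notin_range[OF p(2)] by (force, force)
    have notin': "p \<notin> closed_segment y l" "p \<notin> closed_segment l (- y)"
        "p \<notin> closed_segment (1 + y) y" "p \<notin> closed_segment (- y) (1 - y)"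
      using L1[of p] L2[of p] S1[of p] S2[of p] R by auto
    have n: "p \<notin> closed_segment y (1 + y)" "p \<notin> closed_segment (1 - y) (- y)"
      using notin' by (simp_all add: closed_segment_commute)
    note wn_simps = winding_number_join path_image_join path_join_eq ends notin notin' v v1
    define K where "K = ?g +++ linepath y l +++ linepath l (- y)"
    have "winding_number K p = 0"
    proof (rule elim(1)[rule_format])
      show "path K" "pathfinish K = pathstart K" using v ends by (simp_all add: K_def)
      show "path_image K \<subseteq> range C \<union> {z. R - 1 \<le> \<bar>Re z\<bar> + \<bar>Im z\<bar> \<and> \<sigma> * Re z \<le> 1}"
      proof
        fix z assume "z \<in> path_image K"
        then consider "z \<in> path_image ?g" | "z \<in> closed_segment y l" | "z \<in> closed_segment l (- y)"
          unfolding K_def using ends by (auto simp: path_image_join)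
        then show "z \<in> range C \<union> {z. R - 1 \<le> \<bar>Re z\<bar> + \<bar>Im z\<bar> \<and> \<sigma> * Re z \<le> 1}"
        proof cases
          case 1
          then show ?thesis using im by blast
        next
          case 2
          then show ?thesis using L1[of z] by simp
        next
          case 3
          then show ?thesis using L2[of z] by simp
        qed
      qed
    qed
    then have 1: "winding_number ?g p + winding_number (linepath y l) p + winding_number (linepath l (- y)) p = 0"
      unfolding K_def by (simp add: wn_simps add.assoc)
    \<comment> \<open>The horizontal unit segments carry the ends of \<open>C + 1\<close> back to
      \<open>\<plusminus>\<i> R\<close>, so that the detour is literally the one of
      \<open>K\<close>.\<close>
    define K1 where "K1 = ?g1 +++ linepath (1 + y) y +++ linepath y l +++ linepath l (- y) +++ linepath (- y) (1 - y)"
    have "winding_number K1 p = winding_number (\<lambda>u. K1 u - 1) (p - 1)"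
      unfolding winding_number_offset[of K1 p] winding_number_offset[of "\<lambda>u. K1 u - 1" "p - 1"] by simp
    also have "\<dots> = 0"
    proof (rule elim(2)[rule_format])
      have K1: "path K1" "pathfinish K1 = pathstart K1" using v1 ends by (simp_all add: K1_def)
      then show "path (\<lambda>u. K1 u - 1)" "pathfinish (\<lambda>u. K1 u - 1) = pathstart (\<lambda>u. K1 u - 1)"
        by (auto simp: path_def pathstart_def pathfinish_def intro!: continuous_intros)
      have "z - 1 \<in> range C \<union> {z. R - 1 \<le> \<bar>Re z\<bar> + \<bar>Im z\<bar> \<and> \<sigma> * Re z \<le> 1}" if "z \<in> path_image K1" for z
      proof -
        from that consider "z \<in> path_image ?g1" | "z \<in> closed_segment (1 + y) y" | "z \<in> closed_segment y l"
          | "z \<in> closed_segment l (- y)" | "z \<in> closed_segment (- y) (1 - y)"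
          unfolding K1_def using ends by (auto simp: path_image_join)
        then show ?thesis
        proof cases
          case 1
          then show ?thesis using im1 by auto
        next
          case 2
          then show ?thesis using S1[of z] \<sigma> by auto
        next
          case 3
          then show ?thesis using L1[of z] \<sigma> by auto
        next
          case 4
          then show ?thesis using L2[of z] \<sigma> by auto
        next
          case 5
          then show ?thesis using S2[of z] \<sigma> by auto
        qed
      qed
      then show "path_image (\<lambda>u. K1 u - 1) \<subseteq> range C \<union> {z. R - 1 \<le> \<bar>Re z\<bar> + \<bar>Im z\<bar> \<and> \<sigma> * Re z \<le> 1}"
        unfolding path_image_def by blast
    qed
    finally have 2: "winding_number ?g1 p + winding_number (linepath (1 + y) y) p + winding_number (linepath y l) p +
        winding_number (linepath l (- y)) p + winding_number (linepath (- y) (1 - y)) p = 0"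
      unfolding K1_def by (simp add: wn_simps add.assoc)
    have r: "winding_number (linepath y (1 + y)) p = - winding_number (linepath (1 + y) y) p"
       "winding_number (linepath (1 - y) (- y)) p = - winding_number (linepath (- y) (1 - y)) p"
      using winding_number_reversepath[of "linepath (1 + y) y" p] winding_number_reversepath[of "linepath (- y) (1 - y)" p] notin'
      by simp_all
    have "shift_loop C R = ?g +++ linepath y (1 + y) +++ reversepath ?g1 +++ linepath (1 - y) (- y)"
      by (simp add: shift_loop_def y_def)
    then have "winding_number (shift_loop C R) p = winding_number ?g p + winding_number (linepath y (1 + y)) p
        - winding_number ?g1 p + winding_number (linepath (1 - y) (- y)) p"
      using n by (simp add: wn_simps winding_number_reversepath)
    with 1 2 show ?case unfolding r by algebra
  qed
qed

section \<open>Cauchy's theorem for the truncated loop\<close>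

lemma contour_integral_contour_part:
  assumes C: "deformed_imaginary_axis C" and R: "R > 0"
    and f: "f holomorphic_on S" "open S" "C ` {-R..R} \<subseteq> S"
  shows "f contour_integrable_on contour_part C R"
    and "(contour_integrand C f has_integral contour_integral (contour_part C R) f) {-R..R}"
proof -
  let ?g = "contour_part C R"
  show int: "f contour_integrable_on ?g"
    using f path_image_contour_part[OF R, of C] valid_path_contour_part[OF C R]
    by (intro contour_integrable_holomorphic_simple[of f S]) auto
  obtain X where X: "finite X" "C C1_differentiable_on (UNIV - X)"
    using C by (auto simp: deformed_imaginary_axis_def piecewise_C1_differentiable_on_def)
  let ?F = "\<lambda>u. f (?g u) * vector_derivative ?g (at u)"
  let ?I = "contour_integral ?g f"
  have "(?F has_integral ?I) {0..1}"
    using has_contour_integral_integral[OF int] by (simp add: has_contour_integral)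
  then have "((\<lambda>t. ?F ((1 / (2 * R)) *\<^sub>R t + 1 / 2)) has_integral (?I /\<^sub>R (1 / (2 * R)) ^ DIM(real)))
       (cbox ((0 - 1 / 2) /\<^sub>R (1 / (2 * R))) ((1 - 1 / 2) /\<^sub>R (1 / (2 * R))))"
    using R by (intro has_integral_affinity') auto
  then have "((\<lambda>t. ?F (t / (2 * R) + 1 / 2)) has_integral (2 * R) *\<^sub>R ?I) {-R..R}"
    using R by (simp add: divide_simps)
  then have "((\<lambda>t. (1 / (2 * R)) *\<^sub>R ?F (t / (2 * R) + 1 / 2)) has_integral (1 / (2 * R)) *\<^sub>R (2 * R) *\<^sub>R ?I) {-R..R}"
    by (rule has_integral_cmul)
  then have F: "((\<lambda>t. (1 / (2 * R)) *\<^sub>R ?F (t / (2 * R) + 1 / 2)) has_integral ?I) {-R..R}"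
    using R by simp
  show "(contour_integrand C f has_integral ?I) {-R..R}"
  \<comment> \<open>The two integrands are compared away from the finitely many corners of
    \<open>C\<close>; elsewhere the factor \<open>2 R\<close> of the chain rule cancels the one from
    the affine substitution.\<close>
  proof (rule has_integral_spike_finite[OF X(1) _ F])
    fix t assume t: "t \<in> {-R..R} - X"
    let ?u = "t / (2 * R) + 1 / 2"
    have u: "2 * R * ?u - R = t" using R by (simp add: field_simps)
    have "C differentiable at t" using X(2) t by (simp add: C1_differentiable_on_eq)
    then have "(C has_vector_derivative vector_derivative C (at t)) (at t)"
      by (simp add: vector_derivative_works)
    moreover have "((\<lambda>u. 2 * R * u - R) has_vector_derivative 2 * R) (at ?u)"
      by (auto intro!: derivative_eq_intros simp: has_real_derivative_iff_has_vector_derivative[symmetric])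
    ultimately have "((C \<circ> (\<lambda>u. 2 * R * u - R)) has_vector_derivative (2 * R) *\<^sub>R vector_derivative C (at t)) (at ?u)"
      by (intro vector_diff_chain_at) (simp_all only: u)
    then have "vector_derivative ?g (at ?u) = (2 * R) *\<^sub>R vector_derivative C (at t)"
      by (simp add: contour_part_def o_def vector_derivative_at)
    moreover have "?g ?u = C t" by (simp only: contour_part_def u)
    ultimately show "contour_integrand C f t = (1 / (2 * R)) *\<^sub>R ?F ?u"
      using R by (simp add: contour_integrand_def)
  qed
qed

lemma contour_integral_translate:
  "contour_integral (\<lambda>u. g u + c) f = contour_integral g (\<lambda>z. f (z + c))"
proof -
  have "vector_derivative (\<lambda>u. g u + c) F = vector_derivative g F" for F
    by (simp add: vector_derivative_def has_vector_derivative_add_const)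
  then show ?thesis by (simp add: contour_integral_integral)
qed

text \<open>Since \<open>p\<close> and \<open>p - 1\<close> lie on the same side of
  \<open>C\<close>, the pole \<open>p\<close> is not enclosed between \<open>C\<close> and
  \<open>C + 1\<close>. The loop integral is therefore 0, and the two truncated integrals differ by
  the horizontal segments only. Integrability on the whole line identifies the limit of the
  symmetric truncations with the integral.\<close>

theorem contour_integral_shift:
  assumes C: "deformed_imaginary_axis C"
    and P: "closed P" "\<And>M. finite {p \<in> P. \<bar>Re p\<bar> \<le> M}"
    and side: "\<And>p. p \<in> P \<Longrightarrow> \<exists>\<sigma>. (\<sigma> = 1 \<or> \<sigma> = -1) \<and> on_side C \<sigma> p \<and> on_side C \<sigma> (p - 1)"
    and h: "h holomorphic_on - P"
    and decay: "\<And>e. e > 0 \<Longrightarrow> \<forall>\<^sub>F R in at_top. \<forall>z. 0 \<le> Re z \<and> Re z \<le> 1 \<and> \<bar>Im z\<bar> = R \<longrightarrow> norm (h z) \<le> e"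
    and int: "contour_integrand C (\<lambda>z. h (z + 1) - h z) integrable_on UNIV"
  shows "integral UNIV (contour_integrand C (\<lambda>z. h (z + 1) - h z)) = 0"
proof (rule ccontr)
  let ?u = "contour_integrand C (\<lambda>z. h (z + 1) - h z)"
  let ?I = "integral UNIV ?u"
  assume "?I \<noteq> 0"
  \<comment> \<open>The truncated integral has norm at most \<open>2 e\<close>, one \<open>e\<close>
    for each horizontal segment of length 1, and is within \<open>e\<close> of the full one. So
    \<open>norm ?I < 3 e\<close>, against \<open>norm ?I = 4 e\<close>.\<close>
  define e where "e = norm ?I / 4"
  have e: "e > 0" using \<open>?I \<noteq> 0\<close> by (simp add: e_def)
  obtain T B where T: "T \<ge> 1" "\<And>t. \<bar>t\<bar> \<ge> T \<Longrightarrow> C t = \<i> * of_real t" and B: "\<And>t. \<bar>Re (C t)\<bar> \<le> B"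
    using deformed_imaginary_axisE[OF C] by metis
  have B0: "B \<ge> 0" using B[of 0] by linarith
  \<comment> \<open>Only finitely many poles lie in this strip, so a single \<open>R\<close> serves
    them all. Poles outside the strip are separated from the loop by convexity.\<close>
  let ?Q = "{p \<in> P. \<bar>Re p\<bar> \<le> B + 2}"
  have "(?u has_integral ?I) UNIV" using int by (rule integrable_integral)
  then obtain b where b: "b > 0" "\<And>c d. ball 0 b \<subseteq> cbox c d \<Longrightarrow> norm (integral (cbox c d) ?u - ?I) < e"
    using e unfolding has_integral_alt' by (metis (mono_tags, lifting) UNIV_I integral_cong)
  have "\<forall>\<^sub>F R in at_top. \<forall>p \<in> ?Q. winding_number (shift_loop C R) p = 0 \<and> \<bar>Im p\<bar> < R"
  proof (rule eventually_ball_finite[OF P(2)], rule ballI)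
    fix p assume "p \<in> ?Q"
    then obtain \<sigma> where "\<sigma> = 1 \<or> \<sigma> = -1" "on_side C \<sigma> p" "on_side C \<sigma> (p - 1)" using side by blast
    from winding_number_shift_loop[OF C this] eventually_gt_at_top[of "\<bar>Im p\<bar>"]
    show "\<forall>\<^sub>F R in at_top. winding_number (shift_loop C R) p = 0 \<and> \<bar>Im p\<bar> < R"
      by (rule eventually_conj)
  qed
  moreover have "\<forall>\<^sub>F R in at_top. \<forall>z. 0 \<le> Re z \<and> Re z \<le> 1 \<and> \<bar>Im z\<bar> = R \<longrightarrow> norm (h z) \<le> e"
    using e by (rule decay)
  moreover have "\<forall>\<^sub>F R in at_top. R > max T b" by (rule eventually_gt_at_top)
  ultimately have "\<forall>\<^sub>F R in at_top. norm (integral {-R..R} ?u) \<le> 2 * e \<and> R > b"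
  proof eventually_elim
    case (elim R)
    define y where "y = \<i> * of_real R"
    let ?g = "contour_part C R"
    let ?g1 = "\<lambda>u. contour_part C R u + 1"
    have R: "R > T" "R > b" "R > 0" using elim T by simp_all
    have loop: "shift_loop C R = ?g +++ linepath y (1 + y) +++ reversepath ?g1 +++ linepath (1 - y) (- y)"
      by (simp add: shift_loop_def y_def)
    have v: "valid_path ?g" using valid_path_contour_part[OF C R(3)] .
    then have v1: "valid_path ?g1" using valid_path_offset[of ?g "-1"] by simp
    have ends: "pathstart ?g = - y" "pathfinish ?g = y" "pathstart ?g1 = 1 - y" "pathfinish ?g1 = 1 + y"
      using T(2)[of R] T(2)[of "-R"] R T(1) by (simp_all add: pathstart_def pathfinish_def contour_part_def y_def)
    have im: "path_image ?g = C ` {-R..R}" using path_image_contour_part[OF R(3)] .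
    have "path_image ?g1 = (\<lambda>z. z + 1) ` path_image ?g" unfolding path_image_def image_image ..
    then have im1: "path_image ?g1 = (\<lambda>t. C t + 1) ` {-R..R}" unfolding im image_image .
    have S1: "\<bar>Im z\<bar> = R \<and> 0 \<le> Re z \<and> Re z \<le> 1" if "z \<in> closed_segment y (1 + y)" for z
      using unit_segment[OF that] R by (simp add: y_def)
    have S2: "\<bar>Im z\<bar> = R \<and> 0 \<le> Re z \<and> Re z \<le> 1" if "z \<in> closed_segment (1 - y) (- y)" for z
      using unit_segment[of z "- y"] R that by (simp add: y_def closed_segment_commute)
    have C_P: "C t \<notin> P" "C t + 1 \<notin> P" for t
    proof -
      show "C t \<notin> P" using side[of "C t"] on_side_notin_range by blast
      have "C t + 1 - 1 \<in> range C" by simp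
      then show "C t + 1 \<notin> P" using side[of "C t + 1"] on_side_notin_range by blast
    qed
    have seg_P: "z \<notin> P" if "\<bar>Im z\<bar> = R \<and> 0 \<le> Re z \<and> Re z \<le> 1" for z
      using elim(1) that B0 by force
    have sub: "path_image ?g \<subseteq> - P" "path_image ?g1 \<subseteq> - P" "closed_segment y (1 + y) \<subseteq> - P"
       "closed_segment (1 - y) (- y) \<subseteq> - P"
      using C_P S1 S2 seg_P by (auto simp: im im1)
    have img: "path_image (shift_loop C R) = path_image ?g \<union> closed_segment y (1 + y) \<union> path_image ?g1 \<union> closed_segment (1 - y) (- y)"
      unfolding loop using ends by (auto simp: path_image_join)
    have vl: "valid_path (shift_loop C R)" unfolding loop using v v1 ends by (simp add: valid_path_join)
    have cl: "pathfinish (shift_loop C R) = pathstart (shift_loop C R)" unfolding loop using ends by simp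
    have op: "open (- P)" using P(1) by auto
    have "(h has_contour_integral 0) (shift_loop C R)"
    proof (rule Cauchy_theorem_global[OF op h vl cl])
      show "path_image (shift_loop C R) \<subseteq> - P" unfolding img using sub by blast
      fix p assume "p \<notin> - P"
      show "winding_number (shift_loop C R) p = 0"
      proof (cases "\<bar>Re p\<bar> \<le> B + 2")
        case True
        then show ?thesis using elim(1) \<open>p \<notin> - P\<close> by blast
      next
        case False
        let ?s = "{z. Re z \<le> B + 2} \<inter> {z. Re z \<ge> - (B + 2)}"
        have "z \<in> ?s" if "z \<in> path_image (shift_loop C R)" for z
        proof -
          from that consider t where "z = C t" | t where "z = C t + 1" | "\<bar>Im z\<bar> = R \<and> 0 \<le> Re z \<and> Re z \<le> 1"
            unfolding img im im1 using S1 S2 by blast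
          then show ?thesis
          proof cases
            case (1 t)
            then show ?thesis using B[of t] by auto
          next
            case (2 t)
            then show ?thesis using B[of t] by auto
          qed (use B0 in auto)
        qed
        moreover have "convex ?s" by (intro convex_Int convex_halfspace_Re_le convex_halfspace_Re_ge)
        moreover have "p \<notin> ?s" using False by auto
        ultimately show ?thesis
          using vl cl by (intro winding_number_zero_outside[of _ ?s]) (auto simp: valid_path_imp_path)
      qed
    qed
    then have 0: "contour_integral (shift_loop C R) h = 0" by (rule contour_integral_unique)
    have i: "h contour_integrable_on ?g" "h contour_integrable_on ?g1"
        "h contour_integrable_on linepath y (1 + y)" "h contour_integrable_on linepath (1 - y) (- y)"
      using sub v v1 by (auto intro!: contour_integrable_holomorphic_simple[OF h op])
    have "contour_integral (shift_loop C R) h = contour_integral ?g h + contour_integral (linepath y (1 + y)) h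
        - contour_integral ?g1 h + contour_integral (linepath (1 - y) (- y)) h"
      unfolding loop using i v v1 ends
      by (simp add: contour_integral_reversepath contour_integrable_reversepath_eq)
    with 0 have eq: "contour_integral ?g1 h - contour_integral ?g h =
        contour_integral (linepath y (1 + y)) h + contour_integral (linepath (1 - y) (- y)) h" by algebra
    have n: "norm (contour_integral (linepath y (1 + y)) h) \<le> e" "norm (contour_integral (linepath (1 - y) (- y)) h) \<le> e"
      using contour_integral_bound_linepath[OF i(3), of e] contour_integral_bound_linepath[OF i(4), of e] e elim(2) S1 S2
      by auto
    let ?S = "(\<lambda>z. z + 1) -` (- P)"
    have "(\<lambda>z. z + 1) holomorphic_on ?S" by (intro holomorphic_intros)
    from holomorphic_on_compose_gen[OF this h] have "(\<lambda>z. h (z + 1)) holomorphic_on ?S"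
      by (auto simp: o_def)
    moreover have "open ?S" by (intro open_vimage op continuous_intros)
    ultimately have "(contour_integrand C (\<lambda>z. h (z + 1)) has_integral contour_integral ?g1 h) {-R..R}"
      unfolding contour_integral_translate using C_P by (intro contour_integral_contour_part[OF C R(3)]) auto
    moreover have "(contour_integrand C h has_integral contour_integral ?g h) {-R..R}"
      using contour_integral_contour_part[OF C R(3) h op] C_P by auto
    ultimately have "((\<lambda>t. contour_integrand C (\<lambda>z. h (z + 1)) t - contour_integrand C h t)
        has_integral contour_integral ?g1 h - contour_integral ?g h) {-R..R}"
      by (rule has_integral_diff)
    moreover have "?u = (\<lambda>t. contour_integrand C (\<lambda>z. h (z + 1)) t - contour_integrand C h t)"
      by (simp add: fun_eq_iff contour_integrand_def left_diff_distrib)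
    ultimately have "integral {-R..R} ?u = contour_integral ?g1 h - contour_integral ?g h"
      by (simp add: integral_unique)
    then have "norm (integral {-R..R} ?u) \<le> e + e"
      unfolding eq using n by (auto intro: order.trans[OF norm_triangle_ineq])
    then show ?case using R by simp
  qed
  then obtain R where R: "norm (integral {-R..R} ?u) \<le> 2 * e" "R > b"
    using eventually_happens'[OF trivial_limit_at_top_linorder] by blast
  have "norm (integral (cbox (-R) R) ?u - ?I) < e"
    using R(2) by (intro b) (auto simp: dist_real_def)
  then have "norm ?I < 3 * e" using R(1) norm_triangle_ineq4[of "integral {-R..R} ?u" "integral {-R..R} ?u - ?I"] by simp
  then show False using e by (simp add: e_def)
qed

section \<open>Decay on vertical lines\<close>

text \<open>Decay beyond every power, uniformly on vertical strips. The notion is stable under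
  translation and multiplication by polynomials; \<open>n = 2\<close> serves for integrability and
  \<open>n = 1\<close> for the horizontal segments.\<close>

definition vertical_decay :: "(complex \<Rightarrow> complex) \<Rightarrow> bool" where
  "vertical_decay f \<longleftrightarrow> (\<forall>X n. \<exists>K R. \<forall>z. \<bar>Re z\<bar> \<le> X \<longrightarrow> \<bar>Im z\<bar> \<ge> R \<longrightarrow> norm (f z) \<le> K / \<bar>Im z\<bar> ^ n)"

definition vertically_bounded :: "(complex \<Rightarrow> complex) \<Rightarrow> bool" where
  "vertically_bounded f \<longleftrightarrow> (\<forall>X. \<exists>K R. \<forall>z. \<bar>Re z\<bar> \<le> X \<longrightarrow> \<bar>Im z\<bar> \<ge> R \<longrightarrow> norm (f z) \<le> K)"

lemma vertical_decayE:
  assumes "vertical_decay f"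
  obtains K R where "K \<ge> 0" "R \<ge> 1" "\<And>z. \<bar>Re z\<bar> \<le> X \<Longrightarrow> \<bar>Im z\<bar> \<ge> R \<Longrightarrow> norm (f z) \<le> K / \<bar>Im z\<bar> ^ n"
proof -
  from assms obtain K R where K: "\<And>z. \<bar>Re z\<bar> \<le> X \<Longrightarrow> \<bar>Im z\<bar> \<ge> R \<Longrightarrow> norm (f z) \<le> K / \<bar>Im z\<bar> ^ n"
    unfolding vertical_decay_def by metis
  have "norm (f z) \<le> \<bar>K\<bar> / \<bar>Im z\<bar> ^ n" if "\<bar>Re z\<bar> \<le> X" "\<bar>Im z\<bar> \<ge> max R 1" for z
    
  proof -
    have "K / \<bar>Im z\<bar> ^ n \<le> \<bar>K\<bar> / \<bar>Im z\<bar> ^ n" by (intro divide_right_mono) auto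
    with K[of z] that show ?thesis by simp
  qed
  then show ?thesis by (intro that[of "\<bar>K\<bar>" "max R 1"]) auto
qed

lemma vertical_decay_imp_bounded:
  assumes "vertical_decay f"
  shows "vertically_bounded f"
  unfolding vertically_bounded_def
proof
  fix X
  from assms show "\<exists>K R. \<forall>z. \<bar>Re z\<bar> \<le> X \<longrightarrow> \<bar>Im z\<bar> \<ge> R \<longrightarrow> norm (f z) \<le> K"
    by (rule vertical_decayE[of f X 0]) auto
qed

lemma vertical_decay_cong:
  assumes "vertical_decay f" "\<And>z. \<bar>Im z\<bar> \<ge> c \<Longrightarrow> g z = f z"
  shows "vertical_decay g"
  unfolding vertical_decay_def
proof (intro allI)
  fix X n
  obtain K R where K: "\<And>z. \<bar>Re z\<bar> \<le> X \<Longrightarrow> \<bar>Im z\<bar> \<ge> R \<Longrightarrow> norm (f z) \<le> K / \<bar>Im z\<bar> ^ n"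
    by (rule vertical_decayE[OF assms(1), where X = "X" and n = "n"], rule that)
  show "\<exists>K R. \<forall>z. \<bar>Re z\<bar> \<le> X \<longrightarrow> \<bar>Im z\<bar> \<ge> R \<longrightarrow> norm (g z) \<le> K / \<bar>Im z\<bar> ^ n"
    using K assms(2) by (intro exI[of _ K] exI[of _ "max R c"]) simp
qed

lemma vertical_decay_mult_bounded:
  assumes "vertically_bounded g" "vertical_decay f"
  shows "vertical_decay (\<lambda>z. g z * f z)"
  unfolding vertical_decay_def
proof (intro allI)
  fix X n
  obtain K R where K: "K \<ge> 0" "\<And>z. \<bar>Re z\<bar> \<le> X \<Longrightarrow> \<bar>Im z\<bar> \<ge> R \<Longrightarrow> norm (f z) \<le> K / \<bar>Im z\<bar> ^ n"
    by (rule vertical_decayE[OF assms(2), where X = "X" and n = "n"], rule that)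
  obtain L S where L: "\<And>z. \<bar>Re z\<bar> \<le> X \<Longrightarrow> \<bar>Im z\<bar> \<ge> S \<Longrightarrow> norm (g z) \<le> L"
    using assms(1)[unfolded vertically_bounded_def, rule_format, of X] by auto
  have "norm (g z * f z) \<le> (\<bar>L\<bar> * K) / \<bar>Im z\<bar> ^ n" if "\<bar>Re z\<bar> \<le> X" "\<bar>Im z\<bar> \<ge> max R S" for z
  proof -
    have "norm (g z * f z) \<le> \<bar>L\<bar> * (K / \<bar>Im z\<bar> ^ n)"
    proof (unfold norm_mult, rule mult_mono)
      show "norm (g z) \<le> \<bar>L\<bar>" using L[of z] that by simp
    qed (use K that in auto)
    then show ?thesis by simp
  qed
  then show "\<exists>K R. \<forall>z. \<bar>Re z\<bar> \<le> X \<longrightarrow> \<bar>Im z\<bar> \<ge> R \<longrightarrow> norm (g z * f z) \<le> K / \<bar>Im z\<bar> ^ n" by blast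
qed

lemma vertically_bounded_add:
  assumes "vertically_bounded f" "vertically_bounded g"
  shows "vertically_bounded (\<lambda>z. f z + g z)"
  unfolding vertically_bounded_def
proof
  fix X
  obtain K R where K: "\<And>z. \<bar>Re z\<bar> \<le> X \<Longrightarrow> \<bar>Im z\<bar> \<ge> R \<Longrightarrow> norm (f z) \<le> K"
    using assms(1)[unfolded vertically_bounded_def, rule_format, of X] by auto
  obtain L S where L: "\<And>z. \<bar>Re z\<bar> \<le> X \<Longrightarrow> \<bar>Im z\<bar> \<ge> S \<Longrightarrow> norm (g z) \<le> L"
    using assms(2)[unfolded vertically_bounded_def, rule_format, of X] by auto
  have "norm (f z + g z) \<le> K + L" if "\<bar>Re z\<bar> \<le> X" "\<bar>Im z\<bar> \<ge> max R S" for z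
    using K[of z] L[of z] that norm_triangle_ineq[of "f z" "g z"] by linarith
  then show "\<exists>K R. \<forall>z. \<bar>Re z\<bar> \<le> X \<longrightarrow> \<bar>Im z\<bar> \<ge> R \<longrightarrow> norm (f z + g z) \<le> K" by blast
qed

lemma vertically_bounded_const: "vertically_bounded (\<lambda>_. c)"
  unfolding vertically_bounded_def by (intro allI exI[of _ "norm c"]) simp

lemma vertical_decay_add:
  assumes "vertical_decay f" "vertical_decay g"
  shows "vertical_decay (\<lambda>z. f z + g z)"
  unfolding vertical_decay_def
proof (intro allI)
  fix X n
  obtain K R where K: "\<And>z. \<bar>Re z\<bar> \<le> X \<Longrightarrow> \<bar>Im z\<bar> \<ge> R \<Longrightarrow> norm (f z) \<le> K / \<bar>Im z\<bar> ^ n"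
    by (rule vertical_decayE[OF assms(1), where X = "X" and n = "n"], rule that)
  obtain L S where L: "\<And>z. \<bar>Re z\<bar> \<le> X \<Longrightarrow> \<bar>Im z\<bar> \<ge> S \<Longrightarrow> norm (g z) \<le> L / \<bar>Im z\<bar> ^ n"
    by (rule vertical_decayE[OF assms(2), where X = "X" and n = "n"], rule that)
  have "norm (f z + g z) \<le> (K + L) / \<bar>Im z\<bar> ^ n" if "\<bar>Re z\<bar> \<le> X" "\<bar>Im z\<bar> \<ge> max R S" for z
    using K[of z] L[of z] that norm_triangle_ineq[of "f z" "g z"] unfolding add_divide_distrib by linarith
  then show "\<exists>K R. \<forall>z. \<bar>Re z\<bar> \<le> X \<longrightarrow> \<bar>Im z\<bar> \<ge> R \<longrightarrow> norm (f z + g z) \<le> K / \<bar>Im z\<bar> ^ n" by blast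
qed

lemma vertical_decay_uminus_arg:
  assumes "vertical_decay f"
  shows "vertical_decay (\<lambda>z. f (- z))"
  unfolding vertical_decay_def
proof (intro allI)
  fix X n
  obtain K R where K: "\<And>z. \<bar>Re z\<bar> \<le> X \<Longrightarrow> \<bar>Im z\<bar> \<ge> R \<Longrightarrow> norm (f z) \<le> K / \<bar>Im z\<bar> ^ n"
    by (rule vertical_decayE[OF assms(1), where X = "X" and n = "n"], rule that)
  show "\<exists>K R. \<forall>z. \<bar>Re z\<bar> \<le> X \<longrightarrow> \<bar>Im z\<bar> \<ge> R \<longrightarrow> norm (f (- z)) \<le> K / \<bar>Im z\<bar> ^ n"
    using K[of "- _"] by (intro exI[of _ K] exI[of _ R]) simp
qed

lemma vertical_decay_translate:
  assumes "vertical_decay f"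
  shows "vertical_decay (\<lambda>z. f (z + c))"
  unfolding vertical_decay_def
proof (intro allI)
  fix X n
  obtain K R where K: "K \<ge> 0" "R \<ge> 1" "\<And>z. \<bar>Re z\<bar> \<le> X + \<bar>Re c\<bar> \<Longrightarrow> \<bar>Im z\<bar> \<ge> R \<Longrightarrow> norm (f z) \<le> K / \<bar>Im z\<bar> ^ n"
    by (rule vertical_decayE[OF assms(1), where X = "X + \<bar>Re c\<bar>" and n = "n"], rule that)
  \<comment> \<open>The factor \<open>2 ^ n\<close> pays for
    \<open>|Im (z + c)| \<ge> |Im z| / 2\<close>, which holds high up.\<close>
  have "norm (f (z + c)) \<le> (K * 2 ^ n) / \<bar>Im z\<bar> ^ n" if z: "\<bar>Re z\<bar> \<le> X" "\<bar>Im z\<bar> \<ge> 2 * (R + \<bar>Im c\<bar>)" for z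
  proof -
    have "\<bar>Im z\<bar> \<le> \<bar>Im (z + c)\<bar> + \<bar>Im c\<bar>" by simp
    moreover have "0 \<le> \<bar>Im c\<bar>" by (rule abs_ge_zero)
    ultimately have I: "\<bar>Im (z + c)\<bar> \<ge> \<bar>Im z\<bar> / 2 \<and> \<bar>Im (z + c)\<bar> \<ge> R \<and> \<bar>Im z\<bar> > 0"
      using z(2) K(2) by argo
    have "norm (f (z + c)) \<le> K / \<bar>Im (z + c)\<bar> ^ n" using z I by (intro K(3)) auto
    also have "\<dots> \<le> K / (\<bar>Im z\<bar> / 2) ^ n"
      using K(1,2) I by (intro divide_left_mono power_mono mult_pos_pos zero_less_power) auto
    finally show ?thesis by (simp add: power_divide)
  qed
  then show "\<exists>K R. \<forall>z. \<bar>Re z\<bar> \<le> X \<longrightarrow> \<bar>Im z\<bar> \<ge> R \<longrightarrow> norm (f (z + c)) \<le> K / \<bar>Im z\<bar> ^ n" by blast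
qed

lemma vertical_decay_mult_self:
  assumes "vertical_decay f"
  shows "vertical_decay (\<lambda>z. z * f z)"
  unfolding vertical_decay_def
proof (intro allI)
  fix X n
  obtain K R where K: "K \<ge> 0" "R \<ge> 1" "\<And>z. \<bar>Re z\<bar> \<le> X \<Longrightarrow> \<bar>Im z\<bar> \<ge> R \<Longrightarrow> norm (f z) \<le> K / \<bar>Im z\<bar> ^ Suc n"
    by (rule vertical_decayE[OF assms(1), where X = "X" and n = "Suc n"], rule that)
  have "norm (z * f z) \<le> ((\<bar>X\<bar> + 1) * K) / \<bar>Im z\<bar> ^ n" if z: "\<bar>Re z\<bar> \<le> X" "\<bar>Im z\<bar> \<ge> R" for z
  proof -
    have I: "\<bar>Im z\<bar> \<ge> 1" using z K by simp
    have "norm z \<le> \<bar>Re z\<bar> + \<bar>Im z\<bar>" by (rule cmod_le)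
    also have "\<dots> \<le> \<bar>X\<bar> * \<bar>Im z\<bar> + \<bar>Im z\<bar>"
    proof -
      have "\<bar>X\<bar> * 1 \<le> \<bar>X\<bar> * \<bar>Im z\<bar>" using I by (intro mult_left_mono) auto
      then show ?thesis using z by auto
    qed
    finally have "norm z \<le> (\<bar>X\<bar> + 1) * \<bar>Im z\<bar>" by (simp add: algebra_simps)
    then have "norm (z * f z) \<le> ((\<bar>X\<bar> + 1) * \<bar>Im z\<bar>) * (K / \<bar>Im z\<bar> ^ Suc n)"
      unfolding norm_mult using K z by (intro mult_mono) auto
    also have "\<dots> = ((\<bar>X\<bar> + 1) * K) / \<bar>Im z\<bar> ^ n" using I by (auto simp: field_simps)
    finally show ?thesis .
  qed
  then show "\<exists>K R. \<forall>z. \<bar>Re z\<bar> \<le> X \<longrightarrow> \<bar>Im z\<bar> \<ge> R \<longrightarrow> norm (z * f z) \<le> K / \<bar>Im z\<bar> ^ n" by blast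
qed

lemma vertical_decay_mult_poly:
  assumes "vertical_decay f"
  shows "vertical_decay (\<lambda>z. poly q z * f z)"
proof (induction q)
  case 0
  show ?case using vertical_decay_mult_bounded[OF vertically_bounded_const[of 0] assms] by simp
next
  case (pCons a q)
  have eq: "(\<lambda>z. poly (pCons a q) z * f z) = (\<lambda>z. a * f z + z * (poly q z * f z))"
    by (simp add: distrib_right mult.assoc)
  show ?case
    unfolding eq by (intro vertical_decay_add vertical_decay_mult_bounded[OF vertically_bounded_const] assms
        vertical_decay_mult_self pCons.IH)
qed

section \<open>Decay of the Gamma function and boundedness of the cotangent\<close>

lemma norm_Gamma_le_Gamma_Re:
  fixes z :: complex
  assumes "Re z > 0"
  shows "norm (Gamma z) \<le> Gamma (Re z)"
proof -
  note 1 = Gamma_integral_complex[OF assms] and 2 = Gamma_integral_real[OF assms]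
  have "norm (integral {0..} (\<lambda>t. of_real t powr (z - 1) / of_real (exp t))) \<le> integral {0..} (\<lambda>t. t powr (Re z - 1) / exp t)"
  proof (rule integral_norm_bound_integral)
    show "norm (of_real t powr (z - 1) / complex_of_real (exp t)) \<le> t powr (Re z - 1) / exp t" if "t \<in> {0..}" for t
    proof -
      have "norm (of_real t powr (z - 1) :: complex) = t powr (Re z - 1)"
        using norm_powr_real_powr[of "of_real t" "z - 1"] that by simp
      then show ?thesis unfolding norm_divide by (simp only: norm_of_real abs_exp_cancel order_refl)
    qed
  qed (rule has_integral_integrable[OF 1] has_integral_integrable[OF 2])+
  then show ?thesis using 1 2 by (simp add: integral_unique)
qed

text \<open>No Stirling formula is needed: \<open>\<Gamma>\<close> is bounded on vertical strips in the right half plane, and each use of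
  \<open>\<Gamma>(z) = \<Gamma>(z + 1) / z\<close> gains a factor \<open>1 / |Im z|\<close>.\<close>

lemma vertical_decay_Gamma: "vertical_decay Gamma"
  unfolding vertical_decay_def
proof (intro allI)
  fix X :: real and n :: nat
  \<comment> \<open>Large enough that \<open>Re z + m \<ge> 1\<close> on the whole strip and that at
    least \<open>n\<close> factors \<open>z + i\<close> are available.\<close>
  define m where "m = n + nat \<lceil>\<bar>X\<bar>\<rceil> + 1"
  have m: "real m \<ge> real n + \<bar>X\<bar> + 1" unfolding m_def by linarith
  have "continuous_on {1..2 * \<bar>X\<bar> + m} (Gamma :: real \<Rightarrow> real)"
    by (intro continuous_on_Gamma) (auto simp: nonpos_Ints_def)
  then have "bounded (Gamma ` {1..2 * \<bar>X\<bar> + real m})"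
    by (intro compact_imp_bounded compact_continuous_image) auto
  then obtain K where "\<forall>y \<in> Gamma ` {1..2 * \<bar>X\<bar> + real m}. norm y \<le> K"
    unfolding bounded_iff by blast
  then have K: "Gamma x \<le> K" if "x \<in> {1..2 * \<bar>X\<bar> + m}" for x
    using that by force
  have "norm (Gamma z) \<le> K / \<bar>Im z\<bar> ^ n" if z: "\<bar>Re z\<bar> \<le> X" "\<bar>Im z\<bar> \<ge> 1" for z
  proof -
    have "Im z \<noteq> 0" using z by auto
    then have nz: "z \<notin> \<int>\<^sub>\<le>\<^sub>0" by (auto elim!: nonpos_Ints_cases)
    have x: "Re z + m \<in> {1..2 * \<bar>X\<bar> + m}" using z m by auto
    have "norm (Gamma (z + of_nat m)) \<le> Gamma (Re (z + of_nat m))"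
      using x by (intro norm_Gamma_le_Gamma_Re) auto
    also have "\<dots> \<le> K" using K[OF x] by simp
    finally have 1: "norm (Gamma (z + of_nat m)) \<le> K" .
    have "\<bar>Im z\<bar> ^ n \<le> \<bar>Im z\<bar> ^ m" using z by (intro power_increasing) (auto simp: m_def)
    also have "\<dots> = (\<Prod>i<m. \<bar>Im z\<bar>)" by simp
    also have "\<dots> \<le> (\<Prod>i<m. norm (z + of_nat i))"
      using abs_Im_le_cmod[of "z + of_nat _"] by (intro prod_mono) auto
    also have "\<dots> = norm (pochhammer z m)"
      by (simp add: pochhammer_prod atLeast0LessThan prod_norm)
    finally have 2: "\<bar>Im z\<bar> ^ n \<le> norm (pochhammer z m)" .
    have 3: "\<bar>Im z\<bar> ^ n > 0" using z by simp
    have "norm (Gamma (z + of_nat m)) = norm (pochhammer z m) * norm (Gamma z)"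
      using pochhammer_Gamma[OF nz, of m] Gamma_eq_zero_iff[of z] nz by (simp add: norm_divide)
    then have "\<bar>Im z\<bar> ^ n * norm (Gamma z) \<le> K"
      using 1 mult_right_mono[OF 2, of "norm (Gamma z)"] by simp
    then show ?thesis using 3 by (simp add: field_simps)
  qed
  then show "\<exists>K R. \<forall>z. \<bar>Re z\<bar> \<le> X \<longrightarrow> \<bar>Im z\<bar> \<ge> R \<longrightarrow> norm (Gamma z :: complex) \<le> K / \<bar>Im z\<bar> ^ n" by blast
qed

lemma vertical_decay_Gamma_affine: "vertical_decay (\<lambda>z. Gamma (z + c))" "vertical_decay (\<lambda>z. Gamma (c - z))"
proof -
  show "vertical_decay (\<lambda>z. Gamma (z + c))" by (rule vertical_decay_translate[OF vertical_decay_Gamma])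
  from vertical_decay_uminus_arg[OF this] show "vertical_decay (\<lambda>z. Gamma (c - z))" by simp
qed

text \<open>\<open>exp(iw)\<close> and \<open>exp(-iw)\<close> have reciprocal norms, one at least 2
  and the other at most 1/2. Hence the sum of the norms is at most three times their
  difference.\<close>

lemma norm_cos_le_norm_sin:
  fixes w :: complex
  assumes "\<bar>Im w\<bar> \<ge> 1"
  shows "norm (cos w) \<le> 3 * norm (sin w)" "sin w \<noteq> 0"
proof -
  define a where "a = exp (\<i> * w)"
  define b where "b = exp (- (\<i> * w))"
  have na: "norm a = exp (- Im w)" and nb: "norm b = exp (Im w)" by (simp_all add: a_def b_def)
  have c: "norm (cos w) \<le> (norm a + norm b) / 2"
    unfolding cos_exp_eq using norm_triangle_ineq[of a b] by (simp add: a_def b_def norm_divide)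
  have s: "2 * norm (sin w) = norm (a - b)"
    unfolding sin_exp_eq by (simp add: a_def b_def norm_divide norm_mult)
  have p: "norm a * norm b = 1" unfolding na nb by (simp flip: exp_add)
  have e2: "exp (1::real) \<ge> 2" using exp_ge_add_one_self[of 1] by simp
  have "norm a + norm b \<le> 3 * \<bar>norm a - norm b\<bar> \<and> norm a \<noteq> norm b"
  proof (cases "Im w \<ge> 1")
    case True
    then have b2: "norm b \<ge> 2" using e2 unfolding nb by (metis exp_le_cancel_iff order.trans)
    then have "norm a * 2 \<le> 1" using p mult_left_mono[OF b2, of "norm a"] by simp
    then show ?thesis using b2 by auto
  next
    case False
    then have "- Im w \<ge> 1" using assms by auto
    then have a2: "norm a \<ge> 2" using e2 unfolding na by (metis exp_le_cancel_iff order.trans)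
    then have "2 * norm b \<le> 1" using p mult_right_mono[OF a2, of "norm b"] by simp
    then show ?thesis using a2 by auto
  qed
  moreover have "\<bar>norm a - norm b\<bar> \<le> 2 * norm (sin w)" unfolding s by (rule norm_triangle_ineq3)
  ultimately show "norm (cos w) \<le> 3 * norm (sin w)" "sin w \<noteq> 0" using c by auto
qed

lemma vertically_bounded_cot: "vertically_bounded (\<lambda>z. cot (of_real pi * (z + c)))"
proof -
  have "norm (cot (of_real pi * (z + c))) \<le> 3" if z: "\<bar>Im z\<bar> \<ge> 1 + \<bar>Im c\<bar>" for z
  proof -
    have "\<bar>Im (of_real pi * (z + c))\<bar> = pi * \<bar>Im (z + c)\<bar>" by (simp add: abs_mult)
    moreover have "1 * 1 \<le> pi * \<bar>Im (z + c)\<bar>" using z pi_ge_two by (intro mult_mono) auto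
    ultimately have "\<bar>Im (of_real pi * (z + c))\<bar> \<ge> 1" by simp
    from norm_cos_le_norm_sin[OF this] show ?thesis
      by (simp add: cot_def norm_divide field_simps)
  qed
  then show ?thesis unfolding vertically_bounded_def by blast
qed

lemma integrable_inverse_square_two_sided:
  fixes a :: real
  assumes "a > 0"
  shows "(\<lambda>t. 1 / t ^ 2) integrable_on {a..}" "(\<lambda>t. 1 / t ^ 2) integrable_on {..-a}"
proof -
  show 1: "(\<lambda>t. 1 / t ^ 2) integrable_on {a..}"
    using has_integral_inverse_power_to_inf[of 2 a] assms by (auto simp: integrable_on_def)
  then have "(\<lambda>t::real. 1 / t ^ 2) absolutely_integrable_on {a..}"
    by (intro nonnegative_absolutely_integrable_1) auto
  then have "(\<lambda>t::real. 1 / (- t) ^ 2) absolutely_integrable_on {..-a}"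
    using has_absolute_integral_reflect_real[of "{..-a}" "{a..}" "\<lambda>t. 1 / t ^ 2"] by auto
  then show "(\<lambda>t. 1 / t ^ 2) integrable_on {..-a}"
    using absolutely_integrable_on_def by auto
qed

section \<open>The continuous weight\<close>

lemma contour_integrand_integrable:
  assumes C: "deformed_imaginary_axis C" and F: "F holomorphic_on S" "open S" "range C \<subseteq> S"
    and decay: "vertical_decay F"
  shows "contour_integrand C F integrable_on UNIV"
proof -
  obtain T where T: "T \<ge> 1" "\<And>t. \<bar>t\<bar> \<ge> T \<Longrightarrow> C t = \<i> * of_real t"
    using deformed_imaginary_axisE[OF C] by metis
  obtain K R where K: "K \<ge> 0" "R \<ge> 1" "\<And>z. \<bar>Re z\<bar> \<le> 0 \<Longrightarrow> \<bar>Im z\<bar> \<ge> R \<Longrightarrow> norm (F z) \<le> K / \<bar>Im z\<bar> ^ 2"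
    by (rule vertical_decayE[OF decay, where X = 0 and n = 2], rule that)
  \<comment> \<open>Strictly beyond \<open>T\<close> the contour agrees with the axis on a
    neighbourhood, so its derivative there is \<open>\<i>\<close>.\<close>
  define a where "a = max T R + 1"
  have a: "a > 1" "a > T" "a > R" using T K by (auto simp: a_def)
  define \<phi> where "\<phi> t = F (\<i> * of_real t) * \<i>" for t :: real
  have C_eq: "contour_integrand C F t = \<phi> t" if "\<bar>t\<bar> \<ge> a" for t
  proof -
    have "((\<lambda>t. \<i> * of_real t) has_vector_derivative \<i>) (at t)"
      by (auto intro!: derivative_eq_intros)
    moreover have "open {s. T < \<bar>s\<bar>}" by (intro open_Collect_less continuous_intros)
    ultimately have "(C has_vector_derivative \<i>) (at t)"
      by (rule has_vector_derivative_transform_within_open) (use that a T(2) in auto)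
    then show ?thesis using that a T(2)[of t] by (simp add: contour_integrand_def \<phi>_def vector_derivative_at)
  qed
  have outer: "contour_integrand C F integrable_on X"
    if X: "closed X" "\<And>t. t \<in> X \<Longrightarrow> \<bar>t\<bar> \<ge> a" "(\<lambda>t::real. 1 / t ^ 2) integrable_on X" for X
  proof -
    have "\<phi> integrable_on X"
    proof (rule measurable_bounded_by_integrable_imp_integrable)
      have sub: "(\<lambda>t::real. \<i> * of_real t) ` X \<subseteq> S"
      proof safe
        fix t assume "t \<in> X"
        then have "C t = \<i> * of_real t" using X(2)[of t] a by (intro T(2)) auto
        then show "\<i> * of_real t \<in> S" using F(3) by (metis rangeI subsetD)
      qed
      have "continuous_on X \<phi>"
        unfolding \<phi>_def
        by (intro continuous_intros continuous_on_compose2[OF holomorphic_on_imp_continuous_on[OF F(1)] _ sub])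
      then show "\<phi> \<in> borel_measurable (lebesgue_on X)"
        using X(1) by (intro continuous_imp_measurable_on_sets_lebesgue) auto
      show "(\<lambda>t. K * (1 / t ^ 2)) integrable_on X"
        using X(3) by (rule integrable_on_mult_right)
      show "norm (\<phi> t) \<le> K * (1 / t ^ 2)" if "t \<in> X" for t
        using K(3)[of "\<i> * of_real t"] X(2)[OF that] a by (simp add: \<phi>_def norm_mult)
      show "X \<in> sets lebesgue" using X(1) by auto
    qed
    then show ?thesis by (rule integrable_eq) (use C_eq X(2) in auto)
  qed
  have 1: "contour_integrand C F integrable_on {a..}" "contour_integrand C F integrable_on {..-a}"
    using integrable_inverse_square_two_sided[of a] a by (auto intro!: outer)
  have 2: "contour_integrand C F integrable_on {-a..a}"
    using contour_integral_contour_part(2)[OF C _ F(1,2), of a] a F(3) by (auto simp: integrable_on_def)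
  have 3: "contour_integrand C F integrable_on {-a..}"
    by (rule integrable_Un'[OF 2 1(1)]) (use a in \<open>auto intro: negligible_subset[of "{a}"]\<close>)
  show ?thesis
    by (rule integrable_Un'[OF 3 1(2)]) (use a in \<open>auto intro: negligible_subset[of "{-a}"]\<close>)
qed

section \<open>The weight as a sine times six Gamma factors\<close>

lemma Im_nonzero_notin_nonpos_Ints: "Im w \<noteq> 0 \<Longrightarrow> w \<notin> \<int>\<^sub>\<le>\<^sub>0"
  by (auto elim!: nonpos_Ints_cases)

text \<open>The weight \<open>weight_c\<close> without the factor \<open>2z + A\<close> and the
  constant \<open>-1/\<pi>\<close>; the sine stems from
  \<open>1 / (Gamma(2z+A) Gamma(-2z-A))\<close>. It plays the part of \<open>w\<close> in the
  Pearson equation with \<open>G = 1\<close>.\<close>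

definition gamma_kernel :: "complex \<Rightarrow> complex \<Rightarrow> complex \<Rightarrow> complex" where
  "gamma_kernel A B z = sin (of_real pi * (2 * z + A)) *
     (Gamma (- z) * Gamma (B - A - z) * Gamma (1 - A - z) * Gamma (z + A) * Gamma (z + B) * Gamma (z + 1))"

text \<open>Raising the arguments of the three Gamma factors with poles on the right makes the shift
  by \<open>1\<close> free of residues: a pole \<open>p\<close> lies on the same side of the contour as \<open>p - 1\<close>.\<close>

definition shift_kernel :: "complex \<Rightarrow> complex \<Rightarrow> complex \<Rightarrow> complex" where
  "shift_kernel A B z = sin (of_real pi * (2 * z + A)) *
     (Gamma (1 - z) * Gamma (1 + B - A - z) * Gamma (2 - A - z) * Gamma (z + A) * Gamma (z + B) * Gamma (z + 1))"

text \<open>Every pole of a Gamma factor is listed, whether or not a zero of the sine cancels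
  it.\<close>

definition kernel_poles :: "complex \<Rightarrow> complex \<Rightarrow> complex set" where
  "kernel_poles A B = {z. - z \<in> \<int>\<^sub>\<le>\<^sub>0 \<or> B - A - z \<in> \<int>\<^sub>\<le>\<^sub>0 \<or> 1 - A - z \<in> \<int>\<^sub>\<le>\<^sub>0 \<or>
     z + A \<in> \<int>\<^sub>\<le>\<^sub>0 \<or> z + B \<in> \<int>\<^sub>\<le>\<^sub>0 \<or> z + 1 \<in> \<int>\<^sub>\<le>\<^sub>0}"

definition shift_poles :: "complex \<Rightarrow> complex \<Rightarrow> complex set" where
  "shift_poles A B = {z. 1 - z \<in> \<int>\<^sub>\<le>\<^sub>0 \<or> 1 + B - A - z \<in> \<int>\<^sub>\<le>\<^sub>0 \<or> 2 - A - z \<in> \<int>\<^sub>\<le>\<^sub>0 \<or>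
     z + A \<in> \<int>\<^sub>\<le>\<^sub>0 \<or> z + B \<in> \<int>\<^sub>\<le>\<^sub>0 \<or> z + 1 \<in> \<int>\<^sub>\<le>\<^sub>0}"

lemma closed_nonpos_Ints_vimage:
  fixes f :: "complex \<Rightarrow> complex"
  assumes "continuous_on UNIV f"
  shows "closed {z. f z \<in> \<int>\<^sub>\<le>\<^sub>0}"
  using closed_vimage[OF closed_nonpos_Ints assms] by (simp add: vimage_def)

lemma closed_kernel_poles: "closed (kernel_poles A B)"
  unfolding kernel_poles_def
  by (intro closed_Collect_disj closed_nonpos_Ints_vimage continuous_intros)

lemma closed_shift_poles: "closed (shift_poles A B)"
  unfolding shift_poles_def
  by (intro closed_Collect_disj closed_nonpos_Ints_vimage continuous_intros)

lemma finite_nonpos_Ints_strip: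
  "finite {z. c - z \<in> \<int>\<^sub>\<le>\<^sub>0 \<and> \<bar>Re z\<bar> \<le> M}" "finite {z. z + c \<in> \<int>\<^sub>\<le>\<^sub>0 \<and> \<bar>Re z\<bar> \<le> M}"
proof -
  let ?n = "nat \<lceil>M + \<bar>Re c\<bar>\<rceil>"
  have "z \<in> (\<lambda>k. c + of_nat k) ` {..?n}" if z: "c - z \<in> \<int>\<^sub>\<le>\<^sub>0" "\<bar>Re z\<bar> \<le> M" for z
  proof -
    from z(1) obtain k where "c - z = - of_nat k" by (rule nonpos_Ints_cases')
    then have k: "z = c + of_nat k" by algebra
    then have "k \<le> ?n" using z(2) by simp linarith
    with k show ?thesis by blast
  qed
  then have "{z. c - z \<in> \<int>\<^sub>\<le>\<^sub>0 \<and> \<bar>Re z\<bar> \<le> M} \<subseteq> (\<lambda>k. c + of_nat k) ` {..?n}" by blast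
  then show "finite {z. c - z \<in> \<int>\<^sub>\<le>\<^sub>0 \<and> \<bar>Re z\<bar> \<le> M}" by (rule finite_subset) simp
  have "z \<in> (\<lambda>k. - c - of_nat k) ` {..?n}" if z: "z + c \<in> \<int>\<^sub>\<le>\<^sub>0" "\<bar>Re z\<bar> \<le> M" for z
  proof -
    from z(1) obtain k where "z + c = - of_nat k" by (rule nonpos_Ints_cases')
    then have k: "z = - c - of_nat k" by algebra
    then have "k \<le> ?n" using z(2) by simp linarith
    with k show ?thesis by blast
  qed
  then have "{z. z + c \<in> \<int>\<^sub>\<le>\<^sub>0 \<and> \<bar>Re z\<bar> \<le> M} \<subseteq> (\<lambda>k. - c - of_nat k) ` {..?n}" by blast
  then show "finite {z. z + c \<in> \<int>\<^sub>\<le>\<^sub>0 \<and> \<bar>Re z\<bar> \<le> M}" by (rule finite_subset) simp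
qed

lemma finite_shift_poles_strip: "finite {p \<in> shift_poles A B. \<bar>Re p\<bar> \<le> M}"
proof -
  have "{p \<in> shift_poles A B. \<bar>Re p\<bar> \<le> M} =
     {z. 1 - z \<in> \<int>\<^sub>\<le>\<^sub>0 \<and> \<bar>Re z\<bar> \<le> M} \<union> {z. 1 + B - A - z \<in> \<int>\<^sub>\<le>\<^sub>0 \<and> \<bar>Re z\<bar> \<le> M} \<union>
     {z. 2 - A - z \<in> \<int>\<^sub>\<le>\<^sub>0 \<and> \<bar>Re z\<bar> \<le> M} \<union> {z. z + A \<in> \<int>\<^sub>\<le>\<^sub>0 \<and> \<bar>Re z\<bar> \<le> M} \<union>
     {z. z + B \<in> \<int>\<^sub>\<le>\<^sub>0 \<and> \<bar>Re z\<bar> \<le> M} \<union> {z. z + 1 \<in> \<int>\<^sub>\<le>\<^sub>0 \<and> \<bar>Re z\<bar> \<le> M}"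
    unfolding shift_poles_def by blast
  then show ?thesis by (simp only: finite_Un finite_nonpos_Ints_strip simp_thms)
qed

lemma holomorphic_gamma_kernel: "gamma_kernel A B holomorphic_on - kernel_poles A B"
proof -
  have "(\<lambda>z. sin (of_real pi * (2 * z + A))) holomorphic_on - kernel_poles A B"
    by (intro holomorphic_intros)
  then show ?thesis
    unfolding gamma_kernel_def
    by (intro holomorphic_on_mult holomorphic_Gamma' holomorphic_on_add holomorphic_on_diff holomorphic_on_minus
        holomorphic_on_const holomorphic_on_ident) (unfold kernel_poles_def, blast+)
qed

lemma holomorphic_shift_kernel: "shift_kernel A B holomorphic_on - shift_poles A B"
proof -
  have "(\<lambda>z. sin (of_real pi * (2 * z + A))) holomorphic_on - shift_poles A B"
    by (intro holomorphic_intros)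
  then show ?thesis
    unfolding shift_kernel_def
    by (intro holomorphic_on_mult holomorphic_Gamma' holomorphic_on_add holomorphic_on_diff holomorphic_on_minus
        holomorphic_on_const holomorphic_on_ident) (unfold shift_poles_def, blast+)
qed

text \<open>The two coefficients are those of the Pearson equation for \<open>G = 1\<close>: the
  first uses \<open>Gamma(w+1) = w Gamma(w)\<close> on the factors in \<open>-z\<close>, the second
  on the factors in \<open>z\<close>. The sine is unchanged because its argument moves by a full
  period.\<close>

lemma shift_kernel_eq:
  assumes "z \<notin> kernel_poles A B"
  shows "shift_kernel A B z = - (z * (B - A - z) * (1 - A - z)) * gamma_kernel A B z"
    and "shift_kernel A B (z + 1) = (z + A) * (z + B) * (z + 1) * gamma_kernel A B z"
proof -
  have nz: "- z \<notin> \<int>\<^sub>\<le>\<^sub>0" "B - A - z \<notin> \<int>\<^sub>\<le>\<^sub>0" "1 - A - z \<notin> \<int>\<^sub>\<le>\<^sub>0" "z + A \<notin> \<int>\<^sub>\<le>\<^sub>0" "z + B \<notin> \<int>\<^sub>\<le>\<^sub>0" "z + 1 \<notin> \<int>\<^sub>\<le>\<^sub>0"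
    using assms by (auto simp: kernel_poles_def)
  have e: "1 - z = - z + 1" "1 + B - A - z = (B - A - z) + 1" "2 - A - z = (1 - A - z) + 1"
     "z + 1 + A = (z + A) + 1" "z + 1 + B = (z + B) + 1"
    by simp_all
  have 1: "Gamma (1 - z) = - z * Gamma (- z)" "Gamma (1 + B - A - z) = (B - A - z) * Gamma (B - A - z)"
     "Gamma (2 - A - z) = (1 - A - z) * Gamma (1 - A - z)"
    unfolding e by (rule Gamma_plus1 nz)+
  have 2: "Gamma (z + 1 + A) = (z + A) * Gamma (z + A)" "Gamma (z + 1 + B) = (z + B) * Gamma (z + B)"
     "Gamma (z + 1 + 1) = (z + 1) * Gamma (z + 1)"
    unfolding e by (rule Gamma_plus1 nz)+
  have 3: "1 - (z + 1) = - z" "1 + B - A - (z + 1) = B - A - z" "2 - A - (z + 1) = 1 - A - z" by simp_all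
  have "of_real pi * (2 * (z + 1) + A) = of_real pi * (2 * z + A) + of_real (2 * pi)"
    by (simp add: algebra_simps)
  then have 4: "sin (of_real pi * (2 * (z + 1) + A)) = sin (of_real pi * (2 * z + A))"
    by (simp add: sin_add flip: sin_of_real cos_of_real)
  show "shift_kernel A B z = - (z * (B - A - z) * (1 - A - z)) * gamma_kernel A B z"
    unfolding shift_kernel_def gamma_kernel_def 1 by algebra
  show "shift_kernel A B (z + 1) = (z + A) * (z + B) * (z + 1) * gamma_kernel A B z"
    unfolding shift_kernel_def gamma_kernel_def 2 3 4 by algebra
qed

text \<open>Reflection turns four Gamma factors into \<open>-\<pi>^2 / (sin a sin b)\<close> with
  \<open>a = \<pi> z\<close> and \<open>b = \<pi> (z + A)\<close>. As the kernel's sine is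
  \<open>sin (a + b)\<close>, the quotient is a multiple of \<open>cot a + cot b\<close>, which is
  bounded; \<open>Gamma(z+B) Gamma(B-A-z)\<close> supplies the decay.\<close>

lemma vertical_decay_gamma_kernel: "vertical_decay (gamma_kernel A B)"
proof (rule vertical_decay_cong)
  let ?f = "\<lambda>z. (- (of_real pi)\<^sup>2 :: complex) *
     ((cot (of_real pi * (z + 0)) + cot (of_real pi * (z + A))) * (Gamma (z + B) * Gamma (B - A - z)))"
  show "vertical_decay ?f"
    by (intro vertical_decay_mult_bounded vertically_bounded_const vertically_bounded_add vertically_bounded_cot
        vertical_decay_imp_bounded vertical_decay_Gamma_affine)
  fix z :: complex assume z: "\<bar>Im z\<bar> \<ge> 1 + \<bar>Im A\<bar>"
  define a where "a = of_real pi * z"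
  define b where "b = of_real pi * (z + A)"
  have p: "pi * t \<ge> 1" if "t \<ge> 1" for t
    using mult_mono[of 1 pi 1 t] that pi_ge_two by simp
  have "\<bar>Im z\<bar> \<ge> 1" using z by simp
  then have "\<bar>Im a\<bar> \<ge> 1" using p by (simp add: a_def abs_mult)
  moreover have "\<bar>Im z\<bar> \<le> \<bar>Im (z + A)\<bar> + \<bar>Im A\<bar>" by simp
  then have "\<bar>Im (z + A)\<bar> \<ge> 1" using z by linarith
  then have "\<bar>Im b\<bar> \<ge> 1" using p by (simp add: b_def abs_mult)
  ultimately have s: "sin a \<noteq> 0" "sin b \<noteq> 0" using norm_cos_le_norm_sin(2) by blast+
  have "Gamma (- z) * Gamma (z + 1) = - (of_real pi / sin a)"
    using Gamma_reflection_complex[of "- z"] by (simp add: a_def add.commute)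
  moreover have "Gamma (z + A) * Gamma (1 - A - z) = of_real pi / sin b"
    using Gamma_reflection_complex[of "z + A"] by (simp add: b_def diff_diff_eq add.commute)
  moreover have "sin (of_real pi * (2 * z + A)) = sin a * cos b + cos a * sin b"
    unfolding sin_add[symmetric] by (simp add: a_def b_def algebra_simps)
  moreover have "gamma_kernel A B z = sin (of_real pi * (2 * z + A)) *
     ((Gamma (- z) * Gamma (z + 1)) * (Gamma (z + A) * Gamma (1 - A - z)) * (Gamma (z + B) * Gamma (B - A - z)))"
    unfolding gamma_kernel_def by (simp only: mult_ac)
  ultimately have "gamma_kernel A B z = (sin a * cos b + cos a * sin b) *
     (- (of_real pi / sin a) * (of_real pi / sin b) * (Gamma (z + B) * Gamma (B - A - z)))"
    by simp
  also have "\<dots> = - (of_real pi)\<^sup>2 * ((cot a + cot b) * (Gamma (z + B) * Gamma (B - A - z)))"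
  proof -
    have "(sin a * cos b + cos a * sin b) * (- (of_real pi / sin a) * (of_real pi / sin b)) =
        - (of_real pi)\<^sup>2 * (cot a + cot b)"
    proof -
      have "sin a * inverse (sin a) = 1" "sin b * inverse (sin b) = 1" using s by simp_all
      then show ?thesis unfolding cot_def divide_inverse by algebra
    qed
    then show ?thesis by (simp only: mult.assoc[symmetric])
  qed
  finally show "gamma_kernel A B z = ?f z" by (simp add: a_def b_def)
qed

lemma notin_kernel_poles:
  assumes "\<bar>Im z\<bar> \<ge> 1 + \<bar>Im A\<bar> + \<bar>Im B\<bar>"
  shows "z \<notin> kernel_poles A B"
proof -
  have "- z \<notin> \<int>\<^sub>\<le>\<^sub>0" "B - A - z \<notin> \<int>\<^sub>\<le>\<^sub>0" "1 - A - z \<notin> \<int>\<^sub>\<le>\<^sub>0" "z + A \<notin> \<int>\<^sub>\<le>\<^sub>0" "z + B \<notin> \<int>\<^sub>\<le>\<^sub>0" "z + 1 \<notin> \<int>\<^sub>\<le>\<^sub>0"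
    by (rule Im_nonzero_notin_nonpos_Ints, use assms in simp)+
  then show ?thesis by (simp add: kernel_poles_def)
qed

lemma vertical_decay_shift_kernel: "vertical_decay (\<lambda>z. poly r z * shift_kernel A B z)"
proof (rule vertical_decay_cong)
  let ?q = "r * - ([:0, 1:] * [:B - A, -1:] * [:1 - A, -1:])"
  show "vertical_decay (\<lambda>z. poly ?q z * gamma_kernel A B z)"
    by (rule vertical_decay_mult_poly[OF vertical_decay_gamma_kernel])
  fix z :: complex assume z: "\<bar>Im z\<bar> \<ge> 1 + \<bar>Im A\<bar> + \<bar>Im B\<bar>"
  have "poly ?q z = poly r z * - (z * (B - A - z) * (1 - A - z))" by (simp add: algebra_simps)
  then show "poly r z * shift_kernel A B z = poly ?q z * gamma_kernel A B z"
    unfolding shift_kernel_eq(1)[OF notin_kernel_poles[OF z]] by (simp only: mult.assoc)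
qed

section \<open>The integral as a Pearson functional\<close>

locale separating_contour =
  fixes C :: "real \<Rightarrow> complex" and A B :: complex
  assumes C: "deformed_imaginary_axis C"
    and right: "on_side C 1 (of_nat k)" "on_side C 1 (1 - A + of_nat k)" "on_side C 1 (B - A + of_nat k)"
    and left: "on_side C (-1) (- A - of_nat k)" "on_side C (-1) (- 1 - of_nat k)" "on_side C (-1) (- B - of_nat k)"
begin

text \<open>On the right the poles of the shift kernel start one step late, so \<open>p - 1\<close>
  still belongs to a sequence assumed to lie on the right. On the left \<open>p - 1\<close> is
  simply the next member of its sequence.\<close>

lemma shift_poles_side:
  assumes "p \<in> shift_poles A B"
  shows "\<exists>\<sigma>. (\<sigma> = 1 \<or> \<sigma> = -1) \<and> on_side C \<sigma> p \<and> on_side C \<sigma> (p - 1)"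
proof -
  have R: "\<exists>\<sigma>. (\<sigma> = 1 \<or> \<sigma> = -1) \<and> on_side C \<sigma> p \<and> on_side C \<sigma> (p - 1)"
    if "on_side C 1 (q + of_nat (Suc k))" "on_side C 1 (q + of_nat k)" "q + 1 - p = - of_nat k" for q k
  proof -
    have "p = q + of_nat (Suc k)" using that(3) unfolding of_nat_Suc by algebra
    moreover have "p - 1 = q + of_nat k" using that(3) unfolding of_nat_Suc by algebra
    ultimately show ?thesis using that(1,2) by metis
  qed
  have L: "\<exists>\<sigma>. (\<sigma> = 1 \<or> \<sigma> = -1) \<and> on_side C \<sigma> p \<and> on_side C \<sigma> (p - 1)"
    if "on_side C (-1) (- q - of_nat (Suc k))" "on_side C (-1) (- q - of_nat k)" "p + q = - of_nat k" for q k
  proof -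
    have "p = - q - of_nat k" using that(3) unfolding of_nat_Suc by algebra
    moreover have "p - 1 = - q - of_nat (Suc k)" using that(3) unfolding of_nat_Suc by algebra
    ultimately show ?thesis using that(1,2) by metis
  qed
  from assms consider "1 - p \<in> \<int>\<^sub>\<le>\<^sub>0" | "1 + B - A - p \<in> \<int>\<^sub>\<le>\<^sub>0" | "2 - A - p \<in> \<int>\<^sub>\<le>\<^sub>0"
    | "p + A \<in> \<int>\<^sub>\<le>\<^sub>0" | "p + B \<in> \<int>\<^sub>\<le>\<^sub>0" | "p + 1 \<in> \<int>\<^sub>\<le>\<^sub>0"
    unfolding shift_poles_def by blast
  then show ?thesis
  proof cases
    case 1
    then obtain k where "1 - p = - of_nat k" by (rule nonpos_Ints_cases')
    then show ?thesis using right(1) by (intro R[of 0 k]) (simp_all del: of_nat_Suc)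
  next
    case 2
    then obtain k where "1 + B - A - p = - of_nat k" by (rule nonpos_Ints_cases')
    then show ?thesis using right(3) by (intro R[of "B - A" k]) (simp_all add: algebra_simps del: of_nat_Suc)
  next
    case 3
    then obtain k where "2 - A - p = - of_nat k" by (rule nonpos_Ints_cases')
    then show ?thesis using right(2) by (intro R[of "1 - A" k]) (simp_all add: algebra_simps del: of_nat_Suc)
  next
    case 4
    then obtain k where "p + A = - of_nat k" by (rule nonpos_Ints_cases')
    then show ?thesis using left(1) by (intro L[of A k])
  next
    case 5
    then obtain k where "p + B = - of_nat k" by (rule nonpos_Ints_cases')
    then show ?thesis using left(3) by (intro L[of B k])
  next
    case 6
    then obtain k where "p + 1 = - of_nat k" by (rule nonpos_Ints_cases')
    then show ?thesis using left(2) by (intro L[of 1 k])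
  qed
qed

lemma C_notin_kernel_poles: "C t \<notin> kernel_poles A B"
proof
  have right': "C t \<noteq> of_nat k" "C t \<noteq> 1 - A + of_nat k" "C t \<noteq> B - A + of_nat k" for k
    using right[of k] on_side_notin_range by (metis rangeI)+
  have left': "C t \<noteq> - A - of_nat k" "C t \<noteq> - 1 - of_nat k" "C t \<noteq> - B - of_nat k" for k
    using left[of k] on_side_notin_range by (metis rangeI)+
  assume "C t \<in> kernel_poles A B"
  then consider "- C t \<in> \<int>\<^sub>\<le>\<^sub>0" | "B - A - C t \<in> \<int>\<^sub>\<le>\<^sub>0" | "1 - A - C t \<in> \<int>\<^sub>\<le>\<^sub>0"
    | "C t + A \<in> \<int>\<^sub>\<le>\<^sub>0" | "C t + B \<in> \<int>\<^sub>\<le>\<^sub>0" | "C t + 1 \<in> \<int>\<^sub>\<le>\<^sub>0"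
    unfolding kernel_poles_def by blast
  then show False
  proof cases
    case 1
    then obtain k where "- C t = - of_nat k" by (rule nonpos_Ints_cases')
    then have "C t = of_nat k" by algebra
    then show ?thesis using right'(1) by blast
  next
    case 2
    then obtain k where "B - A - C t = - of_nat k" by (rule nonpos_Ints_cases')
    then have "C t = B - A + of_nat k" by algebra
    then show ?thesis using right'(3) by blast
  next
    case 3
    then obtain k where "1 - A - C t = - of_nat k" by (rule nonpos_Ints_cases')
    then have "C t = 1 - A + of_nat k" by algebra
    then show ?thesis using right'(2) by blast
  next
    case 4
    then obtain k where "C t + A = - of_nat k" by (rule nonpos_Ints_cases')
    then have "C t = - A - of_nat k" by algebra
    then show ?thesis using left'(1) by blast
  next
    case 5
    then obtain k where "C t + B = - of_nat k" by (rule nonpos_Ints_cases')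
    then have "C t = - B - of_nat k" by algebra
    then show ?thesis using left'(3) by blast
  next
    case 6
    then obtain k where "C t + 1 = - of_nat k" by (rule nonpos_Ints_cases')
    then have "C t = - 1 - of_nat k" by algebra
    then show ?thesis using left'(2) by blast
  qed
qed

lemma integrable_gamma_kernel:
  "contour_integrand C (\<lambda>z. poly q z * gamma_kernel A B z) integrable_on UNIV"
proof (rule contour_integrand_integrable[OF C])
  show "(\<lambda>z. poly q z * gamma_kernel A B z) holomorphic_on - kernel_poles A B"
    by (intro holomorphic_intros holomorphic_gamma_kernel)
  show "open (- kernel_poles A B)" using closed_kernel_poles by (simp add: open_Compl)
  show "range C \<subseteq> - kernel_poles A B" using C_notin_kernel_poles by blast
  show "vertical_decay (\<lambda>z. poly q z * gamma_kernel A B z)"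
    by (rule vertical_decay_mult_poly[OF vertical_decay_gamma_kernel])
qed

text \<open>The factor \<open>2z + A\<close> is the counterpart of
  \<open>2x + \<gamma> + \<delta> + 1\<close> in the discrete weight.\<close>

definition kernel_integral :: "complex poly \<Rightarrow> complex" where
  "kernel_integral q = integral UNIV (contour_integrand C (\<lambda>z. poly ([:A, 2:] * q) z * gamma_kernel A B z))"

sublocale pearson_functional kernel_integral A B 1
proof
  fix p q :: "complex poly" and u :: complex
  have "contour_integrand C (\<lambda>z. poly ([:A, 2:] * (p + q)) z * gamma_kernel A B z) =
     (\<lambda>t. contour_integrand C (\<lambda>z. poly ([:A, 2:] * p) z * gamma_kernel A B z) t +
          contour_integrand C (\<lambda>z. poly ([:A, 2:] * q) z * gamma_kernel A B z) t)"
    by (rule ext) (simp only: contour_integrand_def poly_mult poly_add distrib_left distrib_right)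
  then show "kernel_integral (p + q) = kernel_integral p + kernel_integral q"
    unfolding kernel_integral_def by (simp only: integral_add[OF integrable_gamma_kernel integrable_gamma_kernel])
  have "contour_integrand C (\<lambda>z. poly ([:A, 2:] * smult u p) z * gamma_kernel A B z) =
     (\<lambda>t. u * contour_integrand C (\<lambda>z. poly ([:A, 2:] * p) z * gamma_kernel A B z) t)"
    by (rule ext) (simp only: contour_integrand_def poly_mult poly_smult mult_ac)
  then show "kernel_integral (smult u p) = u * kernel_integral p"
    unfolding kernel_integral_def by (simp only: integral_mult_right)
next
  fix q r assume *: "\<And>x. (2 * x + A) * poly q x =
     (x + A) * (x + B) * (x + 1) * poly r (x + 1) + x * (B - A - x) * (1 - A - x) * poly r x"
  \<comment> \<open>The antidifference: off the poles, in particular on the contour, its forward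
    difference is the integrand.\<close>
  let ?h = "\<lambda>z. poly r z * shift_kernel A B z"
  have "?h (z + 1) - ?h z = poly ([:A, 2:] * q) z * gamma_kernel A B z" if "z \<notin> kernel_poles A B" for z
  proof -
    have "poly ([:A, 2:] * q) z = (2 * z + A) * poly q z" by (simp add: algebra_simps)
    then show ?thesis unfolding shift_kernel_eq[OF that] * by algebra
  qed
  then have eq: "contour_integrand C (\<lambda>z. ?h (z + 1) - ?h z) =
     contour_integrand C (\<lambda>z. poly ([:A, 2:] * q) z * gamma_kernel A B z)"
    unfolding contour_integrand_def fun_eq_iff using C_notin_kernel_poles by metis
  have "integral UNIV (contour_integrand C (\<lambda>z. ?h (z + 1) - ?h z)) = 0"
  proof (rule contour_integral_shift[OF C closed_shift_poles finite_shift_poles_strip shift_poles_side])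
    show "?h holomorphic_on - shift_poles A B"
      by (intro holomorphic_intros holomorphic_shift_kernel)
    show "contour_integrand C (\<lambda>z. ?h (z + 1) - ?h z) integrable_on UNIV"
      unfolding eq by (rule integrable_gamma_kernel)
    fix e :: real assume e: "e > 0"
    obtain K R0 where K: "K \<ge> 0" "R0 \<ge> 1"
      "\<And>z. \<bar>Re z\<bar> \<le> 1 \<Longrightarrow> \<bar>Im z\<bar> \<ge> R0 \<Longrightarrow> norm (?h z) \<le> K / \<bar>Im z\<bar> ^ 1"
      by (rule vertical_decayE[OF vertical_decay_shift_kernel[of r A B], where X = 1 and n = 1], rule that)
    have "norm (?h z) \<le> e" if R: "R > max R0 (K / e)" and z: "0 \<le> Re z \<and> Re z \<le> 1 \<and> \<bar>Im z\<bar> = R" for R z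
    proof -
      have "norm (?h z) \<le> K / R" using K(3)[of z] z R by simp
      also have "\<dots> \<le> e" using R e K by (simp add: field_simps)
      finally show ?thesis .
    qed
    then show "\<forall>\<^sub>F R in at_top. \<forall>z. 0 \<le> Re z \<and> Re z \<le> 1 \<and> \<bar>Im z\<bar> = R \<longrightarrow> norm (?h z) \<le> e"
      by (intro eventually_mono[OF eventually_gt_at_top[of "max R0 (K / e)"]]) blast
  qed
  then show "kernel_integral q = 0" unfolding kernel_integral_def eq .
qed

end

section \<open>Identification of the weight and conclusion\<close>

text \<open>The argument of \<open>nu\<close> is chosen so that \<open>\<i> y = -(z + A/2)\<close>,
  whence \<open>a\<close>, \<open>b\<close>, \<open>c\<close> turn into the six Gamma arguments.
  Working with the entire function \<open>rGamma\<close> makes the reflection formula valid without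
  exceptional points.\<close>

lemma weight_c_eq_gamma_kernel:
  fixes \<gamma> \<delta> :: complex and N :: nat
  defines "A \<equiv> \<gamma> + \<delta> + of_nat N + 2" and "B \<equiv> \<gamma> + of_nat N + 2"
  shows "weight_c \<gamma> \<delta> N z = - (1 / of_real pi) * (2 * z + A) * gamma_kernel A B z"
proof -
  let ?y = "z * \<i> + \<i> + \<i> * (\<gamma> + \<delta> + of_nat N) / 2"
  let ?y' = "- z * \<i> - \<i> - \<i> * (\<gamma> + \<delta> + of_nat N) / 2"
  have iy: "\<i> * ?y = - (z + A / 2)" "\<i> * ?y' = z + A / 2" "2 * \<i> * ?y = - (2 * z + A)" "2 * \<i> * ?y' = 2 * z + A"
    by (simp_all add: A_def field_simps)
  have args: "param_a \<gamma> \<delta> N + - (z + A / 2) = - z" "param_b \<gamma> \<delta> N + - (z + A / 2) = B - A - z"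
     "param_c \<gamma> \<delta> N + - (z + A / 2) = 1 - A - z"
     "param_a \<gamma> \<delta> N + (z + A / 2) = z + A" "param_b \<gamma> \<delta> N + (z + A / 2) = z + B" "param_c \<gamma> \<delta> N + (z + A / 2) = z + 1"
    by (simp_all add: param_a_def param_b_def param_c_def A_def B_def field_simps)
  have "rGamma (- (2 * z + A)) = - (2 * z + A) * rGamma (1 - (2 * z + A))"
    using rGamma_plus1[of "- (2 * z + A)"] by (simp add: algebra_simps)
  then have "rGamma (2 * z + A) * rGamma (- (2 * z + A)) =
      - (2 * z + A) * (rGamma (2 * z + A) * rGamma (1 - (2 * z + A)))"
    by (simp only: mult_ac)
  also have "\<dots> = - (2 * z + A) * (sin (of_real pi * (2 * z + A)) / of_real pi)"
    unfolding rGamma_reflection_complex ..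
  finally have r: "rGamma (2 * z + A) * rGamma (- (2 * z + A)) =
      - (2 * z + A) * (sin (of_real pi * (2 * z + A)) / of_real pi)" .
  have "weight_c \<gamma> \<delta> N z = (Gamma (- z) * Gamma (B - A - z) * Gamma (1 - A - z) * Gamma (z + A) * Gamma (z + B) * Gamma (z + 1)) *
     (rGamma (2 * z + A) * rGamma (- (2 * z + A)))"
    unfolding weight_c_def nu_def iy args by (simp only: rGamma_inverse_Gamma divide_inverse mult_ac)
  then show ?thesis unfolding r gamma_kernel_def by (simp add: field_simps)
qed

lemma form_S_commute: "form_S C \<gamma> \<delta> N f g = form_S C \<gamma> \<delta> N g f"
  unfolding form_S_def form_d_commute[of \<gamma> \<delta> N f g]
  by (simp only: form_c_def integrand_c_def mult.commute[of "poly (divided_difference \<gamma> \<delta> (N + 1) f) _"])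

text \<open>A non-integrable function has \<open>integral\<close> equal to 0 by convention. The
  first conjunct ensures that the form is built from genuine integrals.\<close>

theorem mainTheorem7:
  fixes N :: nat and \<gamma> \<delta> a b c :: complex and C :: "real \<Rightarrow> complex"
  assumes "a = param_a \<gamma> \<delta> N" and "b = param_b \<gamma> \<delta> N" and "c = param_c \<gamma> \<delta> N"
    and "2 * a \<notin> \<int>\<^sub>\<le>\<^sub>0" and "a + b \<notin> \<int>\<^sub>\<le>\<^sub>0" and "a + c \<notin> \<int>\<^sub>\<le>\<^sub>0"
    and "2 * b \<notin> \<int>\<^sub>\<le>\<^sub>0" and "b + c \<notin> \<int>\<^sub>\<le>\<^sub>0" and "2 * c \<notin> \<int>\<^sub>\<le>\<^sub>0"
    and "\<And>x. x \<le> N \<Longrightarrow>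
      (-1) ^ x * pochhammer (of_nat x + \<gamma> + \<delta> + 1) (N + 1) * pochhammer (\<delta> + 1) x * fact x \<noteq> 0"
    and "deformed_imaginary_axis C"
    and "\<And>k::nat. right_of_contour C (of_nat k)"
    and "\<And>k::nat. right_of_contour C (- \<gamma> - \<delta> - of_nat N - 1 + of_nat k)"
    and "\<And>k::nat. right_of_contour C (- \<delta> + of_nat k)"
    and "\<And>k::nat. left_of_contour C (- \<gamma> - \<delta> - of_nat N - 2 - of_nat k)"
    and "\<And>k::nat. left_of_contour C (- 1 - of_nat k)"
    and "\<And>k::nat. left_of_contour C (- \<gamma> - of_nat N - 2 - of_nat k)"
  shows "(\<forall>f g. integrand_c C \<gamma> \<delta> N (divided_difference \<gamma> \<delta> (N + 1) f)
                  (divided_difference \<gamma> \<delta> (N + 1) g) integrable_on UNIV) \<and>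
         (\<forall>n m. n \<noteq> m \<longrightarrow> form_S C \<gamma> \<delta> N (dual_hahn \<gamma> \<delta> N n) (dual_hahn \<gamma> \<delta> N m) = 0)"
proof -
  define A where "A = \<gamma> + \<delta> + of_nat N + 2"
  define B where "B = \<gamma> + of_nat N + 2"
  have shifts: "1 - A = - \<gamma> - \<delta> - of_nat N - 1" "B - A = - \<delta>" "- A = - \<gamma> - \<delta> - of_nat N - 2" "- B = - \<gamma> - of_nat N - 2"
    by (simp_all add: A_def B_def)
  interpret separating_contour C A B
    by standard (unfold shifts, use assms(11-) in \<open>simp_all only: right_of_contour_on_side left_of_contour_on_side\<close>)
  have integrand: "integrand_c C \<gamma> \<delta> N F G = (\<lambda>t. - (1 / of_real pi) *
      contour_integrand C (\<lambda>z. poly ([:A, 2:] * (F * G)) z * gamma_kernel A B z) t)" for F G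
    unfolding integrand_c_def contour_integrand_def weight_c_eq_gamma_kernel A_def[symmetric] B_def[symmetric]
    by (simp add: fun_eq_iff algebra_simps)
  have form_c: "form_c C \<gamma> \<delta> N F G = - (1 / of_real pi) * kernel_integral (F * G)" for F G
    unfolding form_c_def integrand kernel_integral_def by (simp only: integral_mult_right)
  have lattice: "quad_lattice \<gamma> \<delta> (Suc N) = lat A"
    by (simp add: quad_lattice_def lat_def A_def algebra_simps)
  have orth: "form_S C \<gamma> \<delta> N (dual_hahn \<gamma> \<delta> N m) (dual_hahn \<gamma> \<delta> N n) = 0" if "n < m" for m n
  proof -
    have "degree (dual_hahn \<gamma> \<delta> N n) < m"
      using degree_hahn_poly[of "\<gamma> + \<delta> + 1" "\<gamma> + 1" "- of_nat N" n] that
      unfolding dual_hahn_eq_hahn_poly by simp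
    then have "form_d \<gamma> \<delta> N (dual_hahn \<gamma> \<delta> N m) (dual_hahn \<gamma> \<delta> N n) = 0"
      by (intro form_d_dual_hahn_eq_0 assms(10))
    moreover have "form_c C \<gamma> \<delta> N (divided_difference \<gamma> \<delta> (N + 1) (dual_hahn \<gamma> \<delta> N m))
        (divided_difference \<gamma> \<delta> (N + 1) (dual_hahn \<gamma> \<delta> N n)) = 0"
    \<comment> \<open>For \<open>n \<le> N\<close> the second argument of the form is the zero
      polynomial, whatever \<open>m\<close> is. For \<open>n > N\<close> both indices exceed
      \<open>N\<close> and lose \<open>N + 1\<close>, which preserves their order.\<close>
    proof (cases "n \<le> N")
      case True
      then show ?thesis
        using divided_difference_dual_hahn_eq_0[OF True, of \<gamma> \<delta>] L_smult[of 0 0]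
        unfolding form_c Suc_eq_plus1 by simp
    next
      case False
      then obtain j where j: "n = Suc N + j" using less_imp_Suc_add[of N n] by auto
      with that obtain i where i: "m = Suc N + i" "j < i"
        by (metis add_less_cancel_left le_iff_add less_imp_le_nat nat_le_iff_add order.strict_trans1 le_add1)
      have "degree (hahn_poly A B 1 j) < i" using degree_hahn_poly[of A B 1 j] i by simp
      from L_hahn_poly_eq_0[OF this] show ?thesis
        unfolding form_c Suc_eq_plus1[symmetric] i j divided_difference_dual_hahn lattice
          A_def[symmetric] B_def[symmetric] by (simp add: L_smult)
    qed
    ultimately show ?thesis by (simp add: form_S_def)
  qed
  have "integrand_c C \<gamma> \<delta> N F G integrable_on UNIV" for F G
    unfolding integrand by (intro integrable_on_mult_right integrable_gamma_kernel)
  moreover have "form_S C \<gamma> \<delta> N (dual_hahn \<gamma> \<delta> N n) (dual_hahn \<gamma> \<delta> N m) = 0" if "n \<noteq> m" for n m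
    using orth[of m n] orth[of n m] form_S_commute that by (metis linorder_neqE_nat)
  ultimately show ?thesis by blast
qed

end
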